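(* Let $\omega\in\widehat{\mathcal D}$ and $\mu\in M^+([0,1))$. Then the following statements are equivalent: (i) $C_{\mu,\omega}:H^\infty\to BMOA$ is bounded; (ii) $C_{\mu,\omega}:H^\infty\to\mathcal B$ is bounded; (iii) $\|\mu_\omega\|_{L^\infty}:=\sup_{0\le r<1}\frac{\widehat\mu(r)}{\widehat\omega(r)(1-r)}<\infty$; (iv) $\|\mu_\omega\|_{\ell^\infty}:=\sup_{n\in\mathbb N_0}\frac{\mu_n(n+1)}{\omega_n}<\infty$. Moreover, $\|C_{\mu,\omega}\|_{H^\infty\to\mathcal B}\asymp\|C_{\mu,\omega}\|_{H^\infty\to BMOA}\asymp\|\mu_\omega\|_{L^\infty}\asymp\|\mu_\omega\|_{\ell^\infty}$.
   Context: $\mathcal H(\mathbb D)$ is the space of analytic functions in the unit disc $\mathbb D$. A weight is an integrable function $\omega:\mathbb D\to[0,\infty)$; it is radial if $\omega(z)=\omega(|z|)$. For a radial weight, $\widehat\omega(r)=\int_r^1\omega(s)\,ds$ and $\omega_x=\int_0^1 r^x\omega(r)\,dr$. $\omega\in\widehat{\mathcal D}$ means: $\omega$ is a radial weight, not a.e. zero, and there is $C>1$ with $\widehat\omega(r)\le C\,\widehat\omega\left(\frac{1+r}2\right)$ for all $0\le r<1$. $M^+([0,1))$ is the set of finite positive Borel measures on $[0,1)$; $\widehat\mu(r)=\mu([r,1))$, $\mu_x=\int_{[0,1)}r^x\,d\mu(r)$ (with $0^0=1$). Kernel: $B^\omega_t(z)=\sum_{n=0}^\infty\frac{(tz)^n}{2\omega_{2n+1}}$,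 $0\le t<1$, $z\in\mathbb D$. Operator: $C_{\mu,\omega}(f)(z)=\int_0^1 f(tz)B^\omega_t(z)\,d\mu(t)$ for $f\in\mathcal H(\mathbb D)$. $H^\infty$ is the space of bounded analytic functions with the sup norm. The Bloch space $\mathcal B$ has norm $\|f\|_{\mathcal B}=|f(0)|+\sup_{z\in\mathbb D}|f'(z)|(1-|z|^2)$. $BMOA$ consists of $f\in H^2$ with $\|f\|_{BMOA}=|f(0)|+\sup_{a\in\mathbb D}\|f\circ\varphi_a-f(a)\|_{H^2}<\infty$, where $\varphi_a(z)=\frac{a-z}{1-\overline a z}$. Bounded $X\to Y$ means $\|C_{\mu,\omega}f\|_Y\le C\|f\|_X$ for all $f\in X$; the operator norm is the least such $C$ (infinite if unbounded). $A\asymp B$ means $c^{-1}B\le A\le cB$ with $c>0$ independent of $\mu$ (it may depend on $\omega$). *)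

theory Defs
  imports "HOL-Complex_Analysis.Complex_Analysis"
begin

abbreviation unit_disc :: "complex set" where
  "unit_disc \<equiv> ball 0 1"


section \<open>Weights\<close>

definition weight :: "(complex \<Rightarrow> real) \<Rightarrow> bool" where
  "weight \<omega> \<longleftrightarrow> set_integrable lebesgue unit_disc \<omega> \<and> (\<forall>z\<in>unit_disc. 0 \<le> \<omega> z)"

definition radial_weight :: "(complex \<Rightarrow> real) \<Rightarrow> bool" where
  "radial_weight \<omega> \<longleftrightarrow> weight \<omega> \<and> (\<forall>z\<in>unit_disc. \<omega> z = \<omega> (complex_of_real (norm z)))"

text \<open>Tail integrals and moments are extended nonnegative reals: integrability over the disc
  alone does not force the tail integral at \<open>0\<close> to be finite. Finiteness at \<open>0\<close> is a
  consequence of the doubling condition in \<open>Dhat\<close> below, and it would be lost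
  if a divergent integral were silently assigned the value \<open>0\<close>.\<close>

definition weight_hat :: "(complex \<Rightarrow> real) \<Rightarrow> real \<Rightarrow> ennreal" where
  "weight_hat \<omega> r = (\<integral>\<^sup>+s\<in>{r..<1}. ennreal (\<omega> (complex_of_real s)) \<partial>lebesgue)"

text \<open>Only moments of integer order are needed; \<open>r ^ n\<close> has the convention \<open>0 ^ 0 = 1\<close>,
  in contrast to \<open>powr\<close>.\<close>

definition weight_moment :: "(complex \<Rightarrow> real) \<Rightarrow> nat \<Rightarrow> ennreal" where
  "weight_moment \<omega> n = (\<integral>\<^sup>+r\<in>{0..<1}. ennreal (r ^ n * \<omega> (complex_of_real r)) \<partial>lebesgue)"

definition Dhat :: "(complex \<Rightarrow> real) set" where
  "Dhat = {\<omega>. radial_weight \<omega>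
             \<and> \<not> (AE z in lebesgue. z \<in> unit_disc \<longrightarrow> \<omega> z = 0)
             \<and> (\<exists>C::real. C > 1 \<and>
                  (\<forall>r. 0 \<le> r \<and> r < 1 \<longrightarrow>
                     weight_hat \<omega> r \<le> ennreal C * weight_hat \<omega> ((1 + r) / 2)))}"


section \<open>Measures on the half-open unit interval\<close>

definition finite_borel_01 :: "real measure set" where
  "finite_borel_01 = {\<mu>. space \<mu> = {0..<1} \<and> sets \<mu> = sets (restrict_space borel {0..<1})
                         \<and> finite_measure \<mu>}"

definition measure_hat :: "real measure \<Rightarrow> real \<Rightarrow> ennreal" where
  "measure_hat \<mu> r = emeasure \<mu> {r..<1}"

definition measure_moment :: "real measure \<Rightarrow> nat \<Rightarrow> ennreal" where
  "measure_moment \<mu> n = (\<integral>\<^sup>+r. ennreal (r ^ n) \<partial>\<mu>)"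

definition L_infty_norm :: "(complex \<Rightarrow> real) \<Rightarrow> real measure \<Rightarrow> ennreal" where
  "L_infty_norm \<omega> \<mu> = (SUP r\<in>{0..<1}. measure_hat \<mu> r / (weight_hat \<omega> r * ennreal (1 - r)))"

definition ell_infty_norm :: "(complex \<Rightarrow> real) \<Rightarrow> real measure \<Rightarrow> ennreal" where
  "ell_infty_norm \<omega> \<mu> = (SUP n. measure_moment \<mu> n * of_nat (n + 1) / weight_moment \<omega> n)"


section \<open>The operator\<close>

definition kernel_B :: "(complex \<Rightarrow> real) \<Rightarrow> real \<Rightarrow> complex \<Rightarrow> complex" where
  "kernel_B \<omega> t z =
     (\<Sum>n. (complex_of_real t * z) ^ n
            / complex_of_real (2 * enn2real (weight_moment \<omega> (2 * n + 1))))"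

definition C_op ::
  "real measure \<Rightarrow> (complex \<Rightarrow> real) \<Rightarrow> (complex \<Rightarrow> complex) \<Rightarrow> complex \<Rightarrow> complex" where
  "C_op \<mu> \<omega> f z = (\<integral>t. f (complex_of_real t * z) * kernel_B \<omega> t z \<partial>\<mu>)"


section \<open>Function spaces on the disc\<close>

text \<open>All norms take values in the extended nonnegative reals and depend only on the
  values of the function on the disc.\<close>

definition Hinf :: "(complex \<Rightarrow> complex) set" where
  "Hinf = {f. f holomorphic_on unit_disc \<and> bounded (f ` unit_disc)}"

definition Hinf_norm :: "(complex \<Rightarrow> complex) \<Rightarrow> ennreal" where
  "Hinf_norm f = (SUP z\<in>unit_disc. ennreal (norm (f z)))"

definition Bloch_norm :: "(complex \<Rightarrow> complex) \<Rightarrow> ennreal" where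
  "Bloch_norm f = ennreal (norm (f 0))
     + (SUP z\<in>unit_disc. ennreal (norm (deriv f z) * (1 - (norm z)\<^sup>2)))"

definition Bloch :: "(complex \<Rightarrow> complex) set" where
  "Bloch = {f. f holomorphic_on unit_disc \<and> Bloch_norm f < \<infinity>}"

definition H2_norm :: "(complex \<Rightarrow> complex) \<Rightarrow> ennreal" where
  "H2_norm f = (SUP r\<in>{0..<1}.
     ennreal (sqrt (1 / (2 * pi) * integral {0..2 * pi} (\<lambda>\<theta>. (norm (f (rcis r \<theta>)))\<^sup>2))))"

definition H2 :: "(complex \<Rightarrow> complex) set" where
  "H2 = {f. f holomorphic_on unit_disc \<and> H2_norm f < \<infinity>}"

definition disc_aut :: "complex \<Rightarrow> complex \<Rightarrow> complex" where
  "disc_aut a z = (a - z) / (1 - cnj a * z)"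

definition BMOA_norm :: "(complex \<Rightarrow> complex) \<Rightarrow> ennreal" where
  "BMOA_norm f = ennreal (norm (f 0))
     + (SUP a\<in>unit_disc. H2_norm (\<lambda>z. f (disc_aut a z) - f a))"

definition BMOA :: "(complex \<Rightarrow> complex) set" where
  "BMOA = {f \<in> H2. BMOA_norm f < \<infinity>}"


section \<open>Boundedness and operator norms\<close>

text \<open>A normed space is given by its carrier together with its norm; a bound for an operator
  includes the requirement that the operator maps into the target carrier.\<close>

definition op_bound ::
  "('a \<Rightarrow> 'b) \<Rightarrow> 'a set \<Rightarrow> ('a \<Rightarrow> ennreal) \<Rightarrow> 'b set \<Rightarrow> ('b \<Rightarrow> ennreal) \<Rightarrow> real \<Rightarrow> bool" where
  "op_bound T X nX Y nY C \<longleftrightarrow>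
     0 \<le> C \<and> (\<forall>f\<in>X. T f \<in> Y \<and> nY (T f) \<le> ennreal C * nX f)"

definition op_bounded ::
  "('a \<Rightarrow> 'b) \<Rightarrow> 'a set \<Rightarrow> ('a \<Rightarrow> ennreal) \<Rightarrow> 'b set \<Rightarrow> ('b \<Rightarrow> ennreal) \<Rightarrow> bool" where
  "op_bounded T X nX Y nY \<longleftrightarrow> (\<exists>C. op_bound T X nX Y nY C)"

text \<open>The infimum over the empty set is \<open>\<infinity>\<close>, the value for an unbounded operator.\<close>

definition op_norm ::
  "('a \<Rightarrow> 'b) \<Rightarrow> 'a set \<Rightarrow> ('a \<Rightarrow> ennreal) \<Rightarrow> 'b set \<Rightarrow> ('b \<Rightarrow> ennreal) \<Rightarrow> ennreal" where
  "op_norm T X nX Y nY = (INF C\<in>{C. op_bound T X nX Y nY C}. ennreal C)"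

definition comparable_on :: "'a set \<Rightarrow> ('a \<Rightarrow> ennreal) \<Rightarrow> ('a \<Rightarrow> ennreal) \<Rightarrow> bool" where
  "comparable_on S A B \<longleftrightarrow>
     (\<exists>c::real. c > 0 \<and> (\<forall>x\<in>S. ennreal (1 / c) * B x \<le> A x \<and> A x \<le> ennreal c * B x))"

end

theory Submission
  imports Defs
begin

text \<open>
  Write \<open>K\<close> for the kernel series, so that the operator is \<open>F z = \<integral> (f K)(t z) d\<mu>(t)\<close>.
  Boundedness into \<open>BMOA\<close> comes from the oscillation estimate
  \<open>|F z - F w| \<le> A (1 + |ln (|1 - z| / |1 - w|)|)\<close>: such an \<open>F\<close> oscillates no more than
  \<open>ln (1 - z)\<close>, whose imaginary part is bounded, and for a holomorphic function vanishing at the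
  origin the real and imaginary parts have the same mean square over circles.

  To prove the estimate, put \<open>s = 1 - t\<close> and \<open>\<rho> = |1 - z| \<le> \<sigma> = |1 - w|\<close>. Doubling gives
  \<open>|K(u)| \<lesssim> 1 / (s W(t))\<close> for \<open>|u| \<le> t\<close>, where \<open>W\<close> is the tail integral of the weight; Cauchy's inequality
  then bounds the difference of \<open>f K\<close> at \<open>t z\<close> and \<open>t w\<close> by \<open>1 / (s W(t)) \<sigma> / s\<close>. The coefficients
  of \<open>K\<close> increase, so that \<open>|1 - u| |K(u)| \<le> s K(t) \<lesssim> 1 / W(t)\<close>, which improves the trivial bound by
  a factor \<open>s / \<rho>\<close>. Under the tail condition on \<open>\<mu>\<close> each dyadic shell in \<open>t\<close> contributes at most a constant
  times \<open>min 1 (min (\<sigma> / s) (s / \<rho>))\<close>.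

  Conversely, testing on \<open>f = 1\<close> yields a power series with nonnegative coefficients, and the Bloch
  condition at \<open>r = 1 - 1 / (2 n)\<close> controls the sum of its terms with index between \<open>n / 2\<close> and \<open>n\<close>.
\<close>

section \<open>Radial weights in polar coordinates\<close>

text \<open>The inclusion of BMOA in the Bloch space is strict, so a growth bound on the derivative
  of F would only reach the Bloch space. Comparison with ln (1 - z) survives composition with disc
  automorphisms: only Re (1 - \<phi>) > 0 is used, which holds for every self-map \<phi> of the
  disc. The point 1 is distinguished because (1 - u) K(u) is under control. The size bound 1 / (s W)
  alone gives a constant per dyadic shell, and there are infinitely many shells. Decay is needed on
  both sides of the range between \<rho> and \<sigma>; as f is merely bounded, the decay for small s
  must come from K alone. A second obstacle is measure theoretic: the weight is Lebesgue measurable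
  in the plane, whereas tails and moments integrate along a radius, so measurability and null sets
  have to be transferred between the two. All norms may be infinite; hence one cycle of inequalities
  between the four quantities contains the equivalences as well as the comparability.\<close>

lemma lebesgue_section_measurable:
  fixes E :: "'b::euclidean_space set"
  assumes "(UNIV :: 'a::euclidean_space set) \<times> E \<in> sets lebesgue"
  shows "E \<in> sets lebesgue"
proof -
  obtain S N N' where SN: "(UNIV :: 'a set) \<times> E = S \<union> N" "N \<subseteq> N'"
    "N' \<in> null_sets lborel" "S \<in> sets lborel"
    using assms by (rule sets_completionE)
  have "AE p in lborel \<Otimes>\<^sub>M lborel. (p :: 'a \<times> 'b) \<notin> N'"
    using SN(3) by (simp add: AE_not_in lborel_prod)
  then have "AE x in lborel. AE y in lborel. (x::'a, y::'b) \<notin> N'"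
    by (rule lborel_pair.AE_pair)
  \<comment> \<open>A section of a Lebesgue set is measurable only for almost every
    \<open>x\<close>. Here all sections equal \<open>E\<close>, so one good \<open>x\<close> is
    enough, and it exists because \<open>lborel\<close> is not the zero measure.\<close>
  then obtain x :: 'a where x: "AE y in lborel. (x, y::'b) \<notin> N'"
    using eventually_happens'[of "ae_filter (lborel :: 'a measure)"]
    by (auto simp: ae_filter_eq_bot_iff emeasure_lborel_UNIV)
  have sN': "Pair x -` N' \<in> sets (lborel :: 'b measure)"
    using SN(3) sets_Pair1[of N' lborel lborel x] unfolding lborel_prod by blast
  have "Pair x -` N' \<in> null_sets lborel"
    using x sN' by (subst AE_iff_null_sets) auto
  moreover have "Pair x -` S \<in> sets (lborel :: 'b measure)"
    using SN(4) sets_Pair1[of S lborel lborel x] unfolding lborel_prod by blast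
  moreover have "E = Pair x -` S \<union> Pair x -` N"
    using SN(1) by auto
  moreover have "Pair x -` N \<subseteq> Pair x -` N'"
    using SN(2) by auto
  ultimately show ?thesis
    by (metis sets_completionI)
qed

text \<open>The differentiable map to (slope, radius) carries the part in the right half-plane onto
  the strip \<open>UNIV \<times> E\<close>, and differentiable maps between spaces of equal
  dimension preserve Lebesgue measurability. The slope, unlike the argument, fills a whole line.
  Radius 0 is excluded because the half-plane misses it.\<close>

lemma lebesgue_sets_if_norm_vimage:
  fixes E :: "real set"
  assumes "{z::complex. norm z \<in> E} \<in> sets lebesgue" and E: "E \<subseteq> {0<..}"
  shows "E \<in> sets lebesgue"
proof -
  let ?f = "\<lambda>z. (Im z / Re z, norm z)"
  define S where "S = {z::complex. norm z \<in> E} \<inter> {z. 0 < Re z}"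
  have "S \<in> sets lebesgue"
    unfolding S_def using assms(1) by (intro sets.Int) (auto simp: open_halfspace_Re_gt)
  moreover have "?f differentiable_on S"
    unfolding S_def differentiable_on_def
  proof
    fix z :: complex assume "z \<in> {z. norm z \<in> E} \<inter> {z. 0 < Re z}"
    then have "z \<noteq> 0" "Re z \<noteq> 0" by auto
    then have "?f differentiable at z"
      by (intro differentiable_Pair differentiable_divide differentiable_norm_at
        bounded_linear_imp_differentiable bounded_linear_Re bounded_linear_Im)
    then show "?f differentiable at z within {z. norm z \<in> E} \<inter> {z. 0 < Re z}"
      by (rule differentiable_at_withinI)
  qed
  ultimately have "?f ` S \<in> sets lebesgue"
    by (intro differentiable_image_in_sets_lebesgue) auto
  moreover have "?f ` S = UNIV \<times> E"
  proof (intro equalityI subsetI)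
    fix p :: "real \<times> real" assume "p \<in> UNIV \<times> E"
    then obtain m r :: real where p: "p = (m, r)" and r: "r \<in> E" by auto
    define q where "q = sqrt (1 + m\<^sup>2)"
    have q: "q > 0" "q\<^sup>2 = 1 + m\<^sup>2"
      by (auto simp: q_def add_pos_nonneg)
    have "r > 0" using r E by auto
    \<comment> \<open>The point of modulus \<open>r\<close> on the ray of slope \<open>m\<close>;
      \<open>q\<close> is the hypotenuse over the legs 1 and \<open>m\<close>.\<close>
    define z where "z = Complex (r / q) (m * r / q)"
    have "1 + m\<^sup>2 \<noteq> 0" using q by auto
    then have "(norm z)\<^sup>2 = r\<^sup>2"
      unfolding cmod_power2 z_def using q by (simp add: power_divide power_mult_distrib flip: add_divide_distrib distrib_right) (simp add: field_simps add_nonneg_eq_0_iff)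
    then have "norm z = r" using \<open>r > 0\<close> by (simp add: power2_eq_iff_nonneg)
    moreover have "Im z / Re z = m" "Re z > 0" using q \<open>r > 0\<close> by (auto simp: z_def)
    ultimately show "p \<in> ?f ` S" using r p by (auto simp: S_def image_iff)
  qed (auto simp: S_def)
  ultimately show ?thesis using lebesgue_section_measurable by metis
qed

text \<open>Polar coordinates are differentiable and so map the null strip over a Borel null set
  containing \<open>E\<close> to a null set.\<close>

lemma negligible_norm_vimage:
  fixes E :: "real set"
  assumes "negligible E"
  shows "negligible {z::complex. norm z \<in> E}"
proof -
  have "E \<in> null_sets (completion lborel)" using assms by (simp add: negligible_iff_null_sets)
  then obtain E' where E': "E \<subseteq> E'" "E' \<in> null_sets (lborel :: real measure)"
    by (auto simp: null_sets_completion_iff2)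
  have "E' \<times> (UNIV :: real set) \<in> null_sets (lborel \<Otimes>\<^sub>M lborel)"
    using E'(2) by (auto simp: null_sets_def lborel.emeasure_pair_measure_Times)
  then have n: "negligible (E' \<times> (UNIV :: real set))"
    by (simp add: lborel_prod negligible_iff_null_sets null_sets_completionI)
  have "negligible ((\<lambda>p. rcis (fst p) (snd p)) ` (E' \<times> (UNIV :: real set)))"
    using n
  proof (rule negligible_differentiable_image_negligible[rotated])
    show "(\<lambda>p. rcis (fst p) (snd p)) differentiable_on E' \<times> UNIV"
      unfolding rcis_def cis_conv_exp differentiable_on_def differentiable_def
    proof (intro ballI exI)
      fix p :: "real \<times> real"
      show "((\<lambda>p. complex_of_real (fst p) * exp (\<i> * complex_of_real (snd p))) has_derivative
        (\<lambda>h. complex_of_real (fst p) * (exp (\<i> * complex_of_real (snd p)) * (\<i> * complex_of_real (snd h)))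
           + complex_of_real (fst h) * exp (\<i> * complex_of_real (snd p)))) (at p within E' \<times> UNIV)"
        by (rule derivative_eq_intros
            has_derivative_compose[OF _ DERIV_exp[unfolded has_field_derivative_def]] refl)+ simp
    qed
  qed auto
  moreover have "{z::complex. norm z \<in> E} \<subseteq> (\<lambda>p. rcis (fst p) (snd p)) ` (E' \<times> (UNIV :: real set))"
  proof
    fix z :: complex assume "z \<in> {z. norm z \<in> E}"
    then show "z \<in> (\<lambda>p. rcis (fst p) (snd p)) ` (E' \<times> (UNIV :: real set))"
      using E'(1) rcis_cmod_Arg[of z] by (intro image_eqI[of _ _ "(norm z, Arg z)"]) auto
  qed
  ultimately show ?thesis by (rule negligible_subset)
qed

text \<open>It suffices to compare half-lines, whose preimages are annuli; differentiating the area
  of a disc gives the density.\<close>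

lemma distr_norm_disc:
  "distr (restrict_space lborel (ball (0::complex) 1)) borel norm
    = density lborel (\<lambda>r. ennreal (2 * pi * r) * indicator {0..1} r)" (is "?M = ?N")
proof (rule measure_eqI_lessThan)
  have M: "emeasure ?M {x<..} = ennreal (pi * (1 - (min 1 (max 0 x))\<^sup>2))" for x
  proof -
    have "emeasure ?M {x<..} = emeasure (restrict_space lborel (ball (0::complex) 1)) (norm -` {x<..} \<inter> ball 0 1)"
      by (subst emeasure_distr) (auto simp: space_restrict_space intro: measurable_restrict_space1)
    also have "\<dots> = emeasure (lborel :: complex measure) (norm -` {x<..} \<inter> ball 0 1)"
      by (rule emeasure_restrict_space) auto
    also have "\<dots> = ennreal (pi * (1 - (min 1 (max 0 x))\<^sup>2))"
    proof (cases "x < 0")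
      case True
      then have "x < norm z" for z :: complex using norm_ge_zero[of z] by linarith
      then have "norm -` {x<..} \<inter> ball 0 1 = ball (0::complex) 1" by auto
      then show ?thesis using True by (simp add: emeasure_ball unit_ball_vol_2)
    next
      case False
      let ?a = "min 1 x"
      have *: "norm -` {x<..} \<inter> ball 0 1 = ball (0::complex) 1 - (ball 0 1 \<inter> cball 0 ?a)"
        by auto
      have **: "emeasure lborel (ball 0 1 \<inter> cball (0::complex) ?a) = ennreal (pi * ?a\<^sup>2)"
      proof (cases "x < 1")
        case True
        then have "ball 0 1 \<inter> cball (0::complex) ?a = cball 0 x" by auto
        then show ?thesis using True False by (simp add: emeasure_cball unit_ball_vol_2)
      next
        case False
        then have "ball 0 1 \<inter> cball (0::complex) ?a = ball 0 1" by auto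
        then show ?thesis using False by (simp add: emeasure_ball unit_ball_vol_2)
      qed
      have "emeasure lborel (norm -` {x<..} \<inter> ball (0::complex) 1) =
          emeasure lborel (ball (0::complex) 1) - emeasure lborel (ball 0 1 \<inter> cball (0::complex) ?a)"
        unfolding * by (rule emeasure_Diff) (auto simp: **)
      also have "\<dots> = ennreal pi - ennreal (pi * ?a\<^sup>2)"
        unfolding ** by (simp add: emeasure_ball unit_ball_vol_2)
      also have "\<dots> = ennreal (pi - pi * ?a\<^sup>2)"
        by (rule ennreal_minus) auto
      finally show ?thesis using False by (simp add: right_diff_distrib max_def)
    qed
    finally show ?thesis .
  qed
  then show "emeasure ?M {x<..} < \<infinity>" for x by simp
  show "emeasure ?M {x<..} = emeasure ?N {x<..}" for x
  proof -
    let ?a = "min 1 (max 0 x)"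
    have "emeasure ?N {x<..} = (\<integral>\<^sup>+r. ennreal (2 * pi * r) * indicator {0..1} r * indicator {x<..} r \<partial>lborel)"
      by (subst emeasure_density) auto
    also have "\<dots> = (\<integral>\<^sup>+r. ennreal (2 * pi * r) * indicator {?a..1} r \<partial>lborel)"
    proof (rule nn_integral_cong_AE)
      \<comment> \<open>The two integrands can differ only at the end points \<open>?a\<close> and
        1.\<close>
      have *: "indicator {0..1} r * indicator {x<..} r = (indicator {?a..1} r :: ennreal)"
        if "r \<noteq> ?a" "r \<noteq> 1" for r
        using that by (simp add: indicator_def) linarith
      show "AE r in lborel. ennreal (2 * pi * r) * indicator {0..1} r * indicator {x<..} r
        = ennreal (2 * pi * r) * indicator {?a..1} r"
        using AE_lborel_singleton[of ?a] AE_lborel_singleton[of 1]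
      proof eventually_elim
        case (elim r)
        from *[OF this] show ?case by (simp only: mult.assoc)
      qed
    qed
    also have "\<dots> = ennreal (pi * 1\<^sup>2 - pi * ?a\<^sup>2)"
      by (rule nn_integral_FTC_Icc) (auto intro!: derivative_eq_intros)
    finally show ?thesis unfolding M by (simp only: right_diff_distrib power_one mult_1_right)
  qed
qed (simp_all only: sets_distr sets_density sets_lborel)

lemma nn_integral_radial_borel:
  assumes h: "h \<in> borel_measurable (borel :: real measure)"
  shows "(\<integral>\<^sup>+z. h (norm z) * indicator (ball 0 1) z \<partial>(lborel :: complex measure))
       = (\<integral>\<^sup>+r. h r * (ennreal (2 * pi * r) * indicator {0..1} r) \<partial>lborel)"
proof -
  have "(\<integral>\<^sup>+z. h (norm z) * indicator (ball 0 1) z \<partial>(lborel :: complex measure))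
      = (\<integral>\<^sup>+z. h (norm z) \<partial>restrict_space lborel (ball (0::complex) 1))"
    by (rule nn_integral_restrict_space[symmetric]) simp
  also have "\<dots> = (\<integral>\<^sup>+r. h r \<partial>distr (restrict_space lborel (ball (0::complex) 1)) borel norm)"
    by (rule nn_integral_distr[symmetric])
      (rule measurable_restrict_space1, simp, simp add: h)
  also have "\<dots> = (\<integral>\<^sup>+r. (ennreal (2 * pi * r) * indicator {0..1} r) * h r \<partial>lborel)"
    unfolding distr_norm_disc by (rule nn_integral_density) (simp_all add: h)
  finally show ?thesis by (simp only: mult.commute)
qed

lemma radial_weight_nonneg:
  assumes "radial_weight \<omega>" "norm z < 1"
  shows "0 \<le> \<omega> z"
proof -
  have "\<forall>z\<in>unit_disc. 0 \<le> \<omega> z"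
    using assms(1) unfolding radial_weight_def weight_def by blast
  then show ?thesis using assms(2) by simp
qed

lemma radial_weight_norm:
  assumes "radial_weight \<omega>" "norm z < 1"
  shows "\<omega> z = \<omega> (complex_of_real (norm z))"
proof -
  have "\<forall>z\<in>unit_disc. \<omega> z = \<omega> (complex_of_real (norm z))"
    using assms(1) unfolding radial_weight_def by blast
  then show ?thesis by (rule bspec) (use assms(2) in simp)
qed

text \<open>Measurability along a ray is not a hypothesis, since the weight is only Lebesgue
  measurable on the disc. By symmetry its superlevel sets there are preimages under the norm, so the
  transfer lemma applies once the origin is removed to keep the radii positive.\<close>

lemma radial_weight_ray_measurable:
  assumes "radial_weight \<omega>"
  shows "(\<lambda>r. \<omega> (complex_of_real r) * indicator {0<..<1} r) \<in> borel_measurable lebesgue"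
proof (rule borel_measurableI_greater)
  fix y :: real
  let ?g = "\<lambda>r. \<omega> (complex_of_real r) * indicator {0<..<1::real} r"
  have rad: "\<omega> z = \<omega> (complex_of_real (norm z))" if "norm z < 1" for z
    using assms that by (rule radial_weight_norm)
  have pos: "0 \<le> \<omega> z" if "norm z < 1" for z
    using assms that by (rule radial_weight_nonneg)
  have int: "set_integrable lebesgue (ball (0::complex) 1) \<omega>"
    using assms unfolding radial_weight_def weight_def by blast
  have "?g -` {y<..} \<in> sets lebesgue"
  proof (cases "y < 0")
    case True
    have "0 \<le> ?g x" for x using pos[of "complex_of_real x"] by (auto split: split_indicator)
    then have "y < ?g x" for x using True by (rule less_le_trans[rotated])
    then have "?g -` {y<..} = UNIV" by auto
    then show ?thesis by simp
  next
    case False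
    have "(\<lambda>z. indicat_real (ball 0 1) z *\<^sub>R \<omega> z) \<in> borel_measurable lebesgue"
      using int unfolding set_integrable_def by auto
    from measurable_sets[OF this, of "{y<..}"]
    have "(\<lambda>z. indicat_real (ball 0 1) z *\<^sub>R \<omega> z) -` {y<..} \<in> sets lebesgue" by auto
    then have "(\<lambda>z. indicat_real (ball 0 1) z *\<^sub>R \<omega> z) -` {y<..} - {0} \<in> sets lebesgue" by auto
    moreover have "(\<lambda>z. indicat_real (ball 0 1) z *\<^sub>R \<omega> z) -` {y<..} - {0} = {z. norm z \<in> ?g -` {y<..}}"
    proof (rule set_eqI)
      fix z :: complex
      show "z \<in> (\<lambda>z. indicat_real (ball 0 1) z *\<^sub>R \<omega> z) -` {y<..} - {0} \<longleftrightarrow> z \<in> {z. norm z \<in> ?g -` {y<..}}"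
      proof (cases "norm z < 1 \<and> z \<noteq> 0")
        case True
        then have "\<omega> (complex_of_real (norm z)) = \<omega> z" using rad[of z] by metis
        then show ?thesis using True by simp
      next
        case outside: False
        then have "z = 0 \<or> indicat_real unit_disc z = 0" "indicat_real {0<..<1} (norm z) = 0"
          by auto
        then show ?thesis using False by auto
      qed
    qed
    ultimately show ?thesis
    proof (intro lebesgue_sets_if_norm_vimage)
      show "?g -` {y<..} \<subseteq> {0<..}"
      proof
        fix x assume "x \<in> ?g -` {y<..}"
        then have "?g x > 0" using False by simp
        then show "x \<in> {0<..}" by (cases "0 < x") simp_all
      qed
    qed simp
  qed
  then show "{x \<in> space lebesgue. y < ?g x} \<in> sets lebesgue"
    by (simp add: vimage_def)
qed

text \<open>The cut-off gives a function on the whole line. Dropping the value at 0 changes no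
  integral and keeps superlevel sets among the positive reals, where measurability can be
  transferred.\<close>

definition ray_density :: "(complex \<Rightarrow> real) \<Rightarrow> real \<Rightarrow> ennreal" where
  "ray_density \<omega> r = ennreal (\<omega> (complex_of_real r) * indicator {0<..<1} r)"

lemma ray_density_measurable:
  assumes "radial_weight \<omega>"
  shows "ray_density \<omega> \<in> borel_measurable lebesgue"
  unfolding ray_density_def[abs_def]
  using radial_weight_ray_measurable[OF assms] by (rule measurable_compose) simp

lemma AE_lebesgue_neq: "AE x in lebesgue. x \<noteq> (c::'a::euclidean_space)"
  using AE_lborel_singleton[of c] by (rule AE_completion)

lemma weight_hat_eq_ray_density:
  assumes "0 \<le> r"
  shows "weight_hat \<omega> r = (\<integral>\<^sup>+s. ray_density \<omega> s * indicator {r..<1} s \<partial>lebesgue)"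
  unfolding weight_hat_def
proof (rule nn_integral_cong_AE)
  show "AE s in lebesgue. ennreal (\<omega> (complex_of_real s)) * indicator {r..<1} s
    = ray_density \<omega> s * indicator {r..<1} s"
    using AE_lebesgue_neq[of "0::real"]
    by eventually_elim (use assms in \<open>auto simp: ray_density_def split: split_indicator\<close>)
qed

lemma weight_moment_eq_ray_density:
  "weight_moment \<omega> n = (\<integral>\<^sup>+s. ray_density \<omega> s * (ennreal (s ^ n) * indicator {0..<1} s) \<partial>lebesgue)"
  unfolding weight_moment_def
proof (rule nn_integral_cong_AE)
  show "AE s in lebesgue. ennreal (s ^ n * \<omega> (complex_of_real s)) * indicator {0..<1} s
    = ray_density \<omega> s * (ennreal (s ^ n) * indicator {0..<1} s)"
    using AE_lebesgue_neq[of "0::real"]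
    by eventually_elim (auto simp: ray_density_def mult.commute ennreal_mult' split: split_indicator)
qed

lemma AE_lebesgue_norm:
  fixes P :: "real \<Rightarrow> bool"
  assumes "AE r in lebesgue. P r"
  shows "AE z in lebesgue. P (norm (z::complex))"
proof -
  have "negligible {r. \<not> P r}"
  proof -
    obtain N where "N \<in> null_sets lebesgue" "{r \<in> space lebesgue. \<not> P r} \<subseteq> N"
      using assms unfolding eventually_ae_filter by blast
    then show ?thesis by (simp add: negligible_iff_null_sets[symmetric] negligible_subset)
  qed
  from negligible_norm_vimage[OF this] show ?thesis
    by (intro AE_I'[of "{z. \<not> P (norm z)}"]) (auto simp: negligible_iff_null_sets)
qed

lemma radial_weight_eq_ray_density:
  assumes "radial_weight \<omega>" "norm z < 1" "z \<noteq> 0"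
  shows "ennreal (\<omega> z) = ray_density \<omega> (norm z)"
proof -
  have "\<omega> z = \<omega> (complex_of_real (norm z))"
    using assms(1,2) by (rule radial_weight_norm)
  then show ?thesis using assms(2,3) by (simp add: ray_density_def)
qed

text \<open>The disc integral is the radial integral against \<open>2 * pi * r\<close>, a factor of
  at least 1 from 1/2 on. It degenerates at 0, so finiteness there has to wait for the doubling
  condition.\<close>

lemma weight_hat_half_finite:
  assumes rw: "radial_weight \<omega>"
  shows "weight_hat \<omega> (1/2) < \<infinity>"
proof -
  \<comment> \<open>The polar formula is available for Borel functions, hence a Borel
    representative.\<close>
  obtain g where g: "g \<in> borel_measurable lborel" "AE r in lborel. ray_density \<omega> r = g r"
    using completion_ex_borel_measurable[OF ray_density_measurable[OF rw]] by blast
  have g_AE: "AE r in lebesgue. ray_density \<omega> r = g r"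
    using g(2) by (rule AE_completion)
  have "set_integrable lebesgue unit_disc \<omega>"
    using rw unfolding radial_weight_def weight_def by blast
  then have "(\<integral>\<^sup>+z. ennreal (norm (indicat_real unit_disc z *\<^sub>R \<omega> z)) \<partial>lebesgue) < \<infinity>"
    unfolding set_integrable_def by (simp add: integrable_iff_bounded)
  also have "(\<integral>\<^sup>+z. ennreal (norm (indicat_real unit_disc z *\<^sub>R \<omega> z)) \<partial>lebesgue)
     = (\<integral>\<^sup>+z. g (norm z) * indicator (ball (0::complex) 1) z \<partial>lebesgue)"
  proof (rule nn_integral_cong_AE)
    have pos: "0 \<le> \<omega> z" if "norm z < 1" for z
      using rw that by (rule radial_weight_nonneg)
    show "AE z in lebesgue. ennreal (norm (indicat_real unit_disc z *\<^sub>R \<omega> z)) = g (norm z) * indicator (ball 0 1) z"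
      using AE_lebesgue_norm[OF g_AE] AE_lebesgue_neq[of "0::complex"]
      by eventually_elim (use pos radial_weight_eq_ray_density[OF rw] in \<open>auto split: split_indicator\<close>)
  qed
  also have "\<dots> = (\<integral>\<^sup>+z. g (norm z) * indicator (ball 0 1) z \<partial>(lborel::complex measure))"
    by (rule nn_integral_completion)
  also have "\<dots> = (\<integral>\<^sup>+r. g r * (ennreal (2 * pi * r) * indicator {0..1} r) \<partial>lborel)"
    using g(1) by (intro nn_integral_radial_borel) simp
  finally have fin: "(\<integral>\<^sup>+r. g r * (ennreal (2 * pi * r) * indicator {0..1} r) \<partial>lborel) < \<infinity>" .
  have "weight_hat \<omega> (1/2) = (\<integral>\<^sup>+s. ray_density \<omega> s * indicator {1/2..<1} s \<partial>lebesgue)"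
    by (rule weight_hat_eq_ray_density) simp
  also have "\<dots> = (\<integral>\<^sup>+s. g s * indicator {1/2..<1} s \<partial>lebesgue)"
    using g_AE by (intro nn_integral_cong_AE) auto
  also have "\<dots> = (\<integral>\<^sup>+s. g s * indicator {1/2..<1} s \<partial>lborel)"
    by (rule nn_integral_completion)
  also have "\<dots> \<le> (\<integral>\<^sup>+r. g r * (ennreal (2 * pi * r) * indicator {0..1} r) \<partial>lborel)"
  proof (intro nn_integral_mono mult_left_mono)
    fix r :: real
    have "1 \<le> 2 * pi * r" if "1/2 \<le> r"
      using mult_mono[of 2 "2 * pi" "1/2" r] that pi_ge_two by simp
    then show "indicator {1/2..<1} r \<le> ennreal (2 * pi * r) * indicator {0..1} r"
      by (auto split: split_indicator)
  qed simp
  finally show ?thesis using fin by (rule le_less_trans)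
qed

section \<open>Dyadic points; positivity and finiteness of the tail integral\<close>

definition dyad :: "nat \<Rightarrow> real" where "dyad k = 1 - (1/2) ^ k"

lemma dyad_0 [simp]: "dyad 0 = 0" by (simp add: dyad_def)

lemma dyad_Suc: "dyad (Suc k) = (1 + dyad k) / 2" by (simp add: dyad_def field_simps)

lemma dyad_range [simp]: "0 \<le> dyad k" "dyad k < 1" by (simp_all add: dyad_def power_le_one)

lemma dyad_mono: "j \<le> k \<Longrightarrow> dyad j \<le> dyad k"
  by (simp add: dyad_def power_decreasing)

lemma dyad_exceeds:
  assumes "r < 1"
  shows "\<exists>k. r < dyad k"
proof -
  obtain k where "(1/2::real) ^ k < 1 - r"
    using real_arch_pow_inv[of "1 - r" "1/2"] assms by auto
  then have "r < dyad k" unfolding dyad_def by linarith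
  then show ?thesis ..
qed

lemma dyad_shell:
  assumes "0 \<le> r" "r < 1"
  obtains k where "dyad k \<le> r" "r < dyad (Suc k)"
proof -
  define m where "m = (LEAST k. r < dyad k)"
  have m: "r < dyad m" unfolding m_def using dyad_exceeds[OF assms(2)] by (rule LeastI_ex)
  then have "m \<noteq> 0" using assms by (intro notI) simp
  then obtain k where k: "m = Suc k" by (cases m) auto
  have "\<not> r < dyad k" using not_less_Least[of k "\<lambda>k. r < dyad k"] k unfolding m_def by simp
  then show ?thesis using that[of k] m k by simp
qed

lemma weight_hat_antimono: "r \<le> s \<Longrightarrow> weight_hat \<omega> s \<le> weight_hat \<omega> r"
  unfolding weight_hat_def by (intro nn_integral_mono) (auto split: split_indicator)

text \<open>By doubling, a zero of the tail propagates backwards along the dyadic points to 0; then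
  the weight vanishes almost everywhere on a ray and therefore on the disc.\<close>

lemma Dhat_weight_hat_pos:
  assumes "\<omega> \<in> Dhat" "0 \<le> r" "r < 1"
  shows "0 < weight_hat \<omega> r"
proof (rule ccontr)
  assume "\<not> 0 < weight_hat \<omega> r"
  then have r0: "weight_hat \<omega> r = 0" by (simp add: not_gr_zero)
  from assms(1) obtain C where C: "\<And>r. 0 \<le> r \<Longrightarrow> r < 1 \<Longrightarrow> weight_hat \<omega> r \<le> ennreal C * weight_hat \<omega> ((1 + r) / 2)"
    and rw: "radial_weight \<omega>" and nz: "\<not> (AE z in lebesgue. z \<in> unit_disc \<longrightarrow> \<omega> z = 0)"
    unfolding Dhat_def by auto
  obtain k where k: "r < dyad k" using dyad_exceeds[OF assms(3)] by blast
  have "weight_hat \<omega> (dyad k) = 0" using weight_hat_antimono[of r "dyad k" \<omega>] k r0 by simp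
  then have "weight_hat \<omega> 0 = 0"
  proof (induction k)
    case (Suc k)
    have "weight_hat \<omega> (dyad k) \<le> ennreal C * weight_hat \<omega> (dyad (Suc k))"
      unfolding dyad_Suc by (rule C) auto
    then show ?case using Suc by simp
  qed simp
  then have "AE s in lebesgue. ray_density \<omega> s * indicator {0..<1} s = 0"
    using ray_density_measurable[OF rw]
    by (subst (asm) weight_hat_eq_ray_density, simp, subst (asm) nn_integral_0_iff_AE)
      (auto intro!: borel_measurable_times_ennreal borel_measurable_indicator)
  then have "AE z in lebesgue. ray_density \<omega> (norm (z::complex)) * indicator {0..<1} (norm z) = 0"
    by (rule AE_lebesgue_norm)
  moreover have "AE z in lebesgue. z \<noteq> (0::complex)" by (rule AE_lebesgue_neq)
  ultimately have "AE z in lebesgue. z \<in> unit_disc \<longrightarrow> \<omega> z = 0"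
  proof eventually_elim
    case (elim z)
    have pos: "0 \<le> \<omega> z" if "norm z < 1"
      using rw that by (rule radial_weight_nonneg)
    show ?case
    proof
      assume z: "z \<in> unit_disc"
      then have "ennreal (\<omega> z) = 0"
        using elim radial_weight_eq_ray_density[OF rw, of z] by (auto simp: indicator_def)
      then show "\<omega> z = 0" using pos z by (simp add: ennreal_eq_0_iff)
    qed
  qed
  with nz show False by contradiction
qed

lemma Dhat_weight_hat_finite:
  assumes "\<omega> \<in> Dhat" "0 \<le> r"
  shows "weight_hat \<omega> r < \<infinity>"
proof -
  from assms(1) obtain C where C: "\<And>r. 0 \<le> r \<Longrightarrow> r < 1 \<Longrightarrow> weight_hat \<omega> r \<le> ennreal C * weight_hat \<omega> ((1 + r) / 2)"
    and rw: "radial_weight \<omega>"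
    unfolding Dhat_def by auto
  have "weight_hat \<omega> r \<le> weight_hat \<omega> 0" using assms(2) by (rule weight_hat_antimono)
  also have "\<dots> \<le> ennreal C * weight_hat \<omega> (1/2)" using C[of 0] by simp
  also have "\<dots> < \<infinity>" using weight_hat_half_finite[OF rw] by (simp add: ennreal_mult_less_top)
  finally show ?thesis .
qed

section \<open>Dyadic estimates for moments\<close>

text \<open>Tails replace shells: at each \<open>t\<close> a single term of the nonnegative series
  already dominates \<open>h t\<close>, and the others do no harm in an upper bound. The estimate
  thus needs information on tails only.\<close>

lemma nn_integral_le_dyadic_tails:
  fixes h :: "real \<Rightarrow> ennreal"
  assumes sets: "\<And>k. {dyad k..<1} \<in> sets \<nu>"
    and h: "\<And>t. 0 \<le> t \<Longrightarrow> t < 1 \<Longrightarrow> \<exists>k. dyad k \<le> t \<and> h t \<le> b k"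
  shows "(\<integral>\<^sup>+t. h t * indicator {0..<1} t \<partial>\<nu>) \<le> (\<Sum>k. b k * emeasure \<nu> {dyad k..<1})"
proof -
  have "(\<integral>\<^sup>+t. h t * indicator {0..<1} t \<partial>\<nu>) \<le> (\<integral>\<^sup>+t. (\<Sum>k. b k * indicator {dyad k..<1} t) \<partial>\<nu>)"
  proof (rule nn_integral_mono)
    fix t
    show "h t * indicator {0..<1} t \<le> (\<Sum>k. b k * indicator {dyad k..<1} t)"
    proof (cases "0 \<le> t \<and> t < 1")
      case True
      then obtain k where k: "dyad k \<le> t" "h t \<le> b k" using h by blast
      have "h t * indicator {0..<1} t \<le> sum (\<lambda>k. b k * indicator {dyad k..<1} t) {k}"
        using True k by simp
      also have "\<dots> \<le> (\<Sum>k. b k * indicator {dyad k..<1} t)"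
        by (rule sum_le_suminf) auto
      finally show ?thesis .
    qed simp
  qed
  also have "\<dots> = (\<Sum>k. \<integral>\<^sup>+t. b k * indicator {dyad k..<1} t \<partial>\<nu>)"
    using sets by (intro nn_integral_suminf) simp
  also have "\<dots> = (\<Sum>k. b k * emeasure \<nu> {dyad k..<1})"
    using sets by (simp add: nn_integral_cmult_indicator)
  finally show ?thesis .
qed

text \<open>Weighs the growth of tails over \<open>i\<close> doublings, \<open>D ^ i\<close>,
  against the size of t^n on the shell \<open>i\<close> steps before the scale 1 - 1/n.\<close>

definition growth_const :: "real \<Rightarrow> real" where
  "growth_const D = (\<Sum>i. D ^ i * exp (- (2 ^ i / 4)))"

lemma summable_growth:
  fixes D :: real
  assumes "0 < D"
  shows "summable (\<lambda>i. D ^ i * exp (- (2 ^ i / 4)))"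
\<comment> \<open>Consecutive terms have ratio D exp (- 2^i / 4), which is at most 1/2 once 8 D
  \<le> 2^i; since i \<le> 2^i, the stated threshold suffices.\<close>
proof (rule summable_ratio_test[where c = "1/2" and N = "nat \<lceil>8 * D\<rceil>"])
  fix i assume i: "nat \<lceil>8 * D\<rceil> \<le> i"
  have "8 * D \<le> real i" using i by linarith
  also have "\<dots> \<le> 2 ^ i" using less_exp[of i] of_nat_mono[of i "2 ^ i", where ?'a = real] by simp
  finally have "2 * D \<le> 2 ^ i / 4" by simp
  also have "\<dots> \<le> exp (2 ^ i / 4)" using exp_ge_add_one_self[of "2 ^ i / 4 :: real"] by linarith
  finally have *: "D * exp (- (2 ^ i / 4)) \<le> 1 / 2" by (simp add: exp_minus field_simps)
  have "norm (D ^ Suc i * exp (- (2 ^ Suc i / 4))) = (D * exp (- (2 ^ i / 4))) * (D ^ i * exp (- (2 ^ i / 4)))"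
  proof -
    have "exp (- (2 ^ Suc i / 4) :: real) = exp (- (2 ^ i / 4)) * exp (- (2 ^ i / 4))"
      unfolding mult_exp_exp by (rule arg_cong[of _ _ exp]) simp
    then show ?thesis using assms by (simp add: abs_mult)
  qed
  also have "\<dots> \<le> 1/2 * (D ^ i * exp (- (2 ^ i / 4)))"
    using * assms by (intro mult_right_mono) auto
  finally show "norm (D ^ Suc i * exp (- (2 ^ Suc i / 4))) \<le> 1/2 * norm (D ^ i * exp (- (2 ^ i / 4)))"
    using assms by (simp add: abs_mult)
qed simp

lemma growth_term_le:
  assumes "0 < D"
  shows "D ^ i * exp (- (2 ^ i / 4)) \<le> growth_const D"
proof -
  have "sum (\<lambda>i. D ^ i * exp (- (2 ^ i / 4))) {i} \<le> growth_const D"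
    unfolding growth_const_def using assms by (intro sum_le_suminf summable_growth) auto
  then show ?thesis by simp
qed

lemma growth_const_pos: "0 < D \<Longrightarrow> 0 < growth_const D"
  by (rule less_le_trans[OF _ growth_term_le[of D 0]]) simp_all

lemma one_minus_power_le_exp:
  fixes x :: real
  assumes "x \<le> 1"
  shows "(1 - x) ^ n \<le> exp (- (real n * x))"
proof -
  have "(1 - x) ^ n \<le> exp (- x) ^ n"
    using assms exp_ge_add_one_self[of "-x"] by (intro power_mono) auto
  also have "\<dots> = exp (- (real n * x))" using exp_of_nat_mult[of n "-x"] by simp
  finally show ?thesis .
qed

text \<open>Before \<open>dyad j\<close> the power t^n decays doubly exponentially in the distance
  \<open>j - k\<close>, which beats the geometric growth of the tails. The lemma serves the weight
  with D = C and \<mu> with D = 2 C.\<close>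

lemma moment_le_dyadic_tail:
  assumes sets: "\<And>k. {dyad k..<1} \<in> sets \<nu>"
    and D: "0 < D" and A: "0 \<le> A" and n: "2 ^ j \<le> Suc n"
    and tail: "\<And>k. k \<le> j \<Longrightarrow> emeasure \<nu> {dyad k..<1} \<le> ennreal (D ^ (j - k) * A)"
  shows "(\<integral>\<^sup>+t. ennreal (t ^ n) * indicator {0..<1} t \<partial>\<nu>) \<le> ennreal (exp 1 * growth_const D * A)"
proof -
  \<comment> \<open>From \<open>dyad j\<close> on everything is lumped into one tail with bound 1,
    which makes the series finite; on an earlier shell the power is bounded at the right end
    point.\<close>
  define b where "b k = (if k < j then ennreal (dyad (Suc k) ^ n) else if k = j then 1 else 0)" for k
  define c where "c i = exp 1 * (D ^ i * exp (- (2 ^ i / 4))) * A" for i :: nat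
  have c0: "0 \<le> c i" for i using D A by (simp add: c_def)
  have "(\<integral>\<^sup>+t. ennreal (t ^ n) * indicator {0..<1} t \<partial>\<nu>) \<le> (\<Sum>k. b k * emeasure \<nu> {dyad k..<1})"
  proof (rule nn_integral_le_dyadic_tails[OF sets])
    fix t :: real assume t: "0 \<le> t" "t < 1"
    then obtain k where k: "dyad k \<le> t" "t < dyad (Suc k)" by (rule dyad_shell)
    show "\<exists>k. dyad k \<le> t \<and> ennreal (t ^ n) \<le> b k"
    proof (cases "k < j")
      case True
      then show ?thesis using k t by (intro exI[of _ k]) (auto simp: b_def intro!: ennreal_leI power_mono)
    next
      case False
      then have "dyad j \<le> t" using dyad_mono[of j k] k by simp
      moreover have "t ^ n \<le> 1" using t by (simp add: power_le_one)
      ultimately show ?thesis by (intro exI[of _ j]) (simp add: b_def)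
    qed
  qed
  also have "\<dots> = (\<Sum>k<Suc j. b k * emeasure \<nu> {dyad k..<1})"
    by (rule suminf_finite) (auto simp: b_def)
  also have "\<dots> \<le> (\<Sum>k<Suc j. ennreal (c (Suc j - Suc k)))"
  proof (rule sum_mono)
    fix k assume "k \<in> {..<Suc j}"
    then have k: "k \<le> j" by simp
    have "b k \<le> ennreal (exp 1 * exp (- (2 ^ (j - k) / 4)))"
    proof (cases "k = j")
      case True
      have "1 \<le> exp 1 * exp (- (1 / 4) :: real)"
        by (simp add: mult_exp_exp)
      from ennreal_leI[OF this] show ?thesis using True by (simp add: b_def)
    next
      case False
      then have kj: "k < j" using k by simp
      have "dyad (Suc k) ^ n \<le> exp (- (real n * (1/2) ^ Suc k))"
        unfolding dyad_def by (rule one_minus_power_le_exp) (rule power_le_one, auto)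
      \<comment> \<open>The assumption is on n + 1, not n. The resulting loss of 1/2 in the exponent
        is absorbed by \<open>exp 1\<close>.\<close>
      also have "\<dots> \<le> exp (1 - 2 ^ (j - k) / 4)"
      proof -
        have "2 ^ (j - k) * 2 ^ k = (2 ^ j :: real)" using k by (simp flip: power_add)
        then have "2 ^ (j - k) / 2 = 2 ^ j * ((1/2::real) ^ Suc k)"
          by (simp add: power_divide field_simps)
        also have "\<dots> \<le> (real n + 1) * (1/2) ^ Suc k"
          using of_nat_mono[OF n, where ?'a = real] by (intro mult_right_mono) auto
        also have "\<dots> \<le> real n * (1/2) ^ Suc k + 1/2"
        proof -
          have "(1/2::real) ^ k \<le> 1" by (rule power_le_one) auto
          then have "(1/2::real) ^ Suc k \<le> 1/2" by simp
          then show ?thesis by (simp only: distrib_right mult_1_left add_left_mono)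
        qed
        finally have *: "2 ^ (j - k) / 2 \<le> real n * (1/2) ^ Suc k + 1/2" .
        have "0 \<le> (2::real) ^ (j - k)" by simp
        with * have "- (real n * (1/2) ^ Suc k) \<le> 1 - 2 ^ (j - k) / 4" by linarith
        then show ?thesis by simp
      qed
      also have "\<dots> = exp 1 * exp (- (2 ^ (j - k) / 4))" by (simp add: mult_exp_exp)
      finally show ?thesis using kj by (simp add: b_def ennreal_leI)
    qed
    then have "b k * emeasure \<nu> {dyad k..<1}
        \<le> ennreal (exp 1 * exp (- (2 ^ (j - k) / 4))) * ennreal (D ^ (j - k) * A)"
      using tail[OF k] by (rule mult_mono) auto
    also have "\<dots> = ennreal (c (Suc j - Suc k))"
      unfolding c_def using D A by (subst ennreal_mult[symmetric]) (simp_all add: mult_ac)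
    finally show "b k * emeasure \<nu> {dyad k..<1} \<le> ennreal (c (Suc j - Suc k))" .
  qed
  also have "\<dots> = ennreal (\<Sum>k<Suc j. c (Suc j - Suc k))"
    using c0 by (rule sum_ennreal)
  also have "(\<Sum>k<Suc j. c (Suc j - Suc k)) = (\<Sum>i<Suc j. c i)"
    by (rule sum.nat_diff_reindex)
  also have "\<dots> \<le> exp 1 * growth_const D * A"
  proof -
    have "(\<Sum>i<Suc j. D ^ i * exp (- (2 ^ i / 4))) \<le> growth_const D"
      unfolding growth_const_def using D by (intro sum_le_suminf summable_growth) auto
    then have "exp 1 * (\<Sum>i<Suc j. D ^ i * exp (- (2 ^ i / 4))) * A \<le> exp 1 * growth_const D * A"
      using A by (intro mult_right_mono mult_left_mono) auto
    then show ?thesis unfolding c_def sum_distrib_left sum_distrib_right .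
  qed
  finally show ?thesis by (simp add: ennreal_leI)
qed

text \<open>The numbers (1 - 2^-j)^(2^j) increase from the value 1/4 at j = 1, because x \<le> ((1 +
  x) / 2)^2. For j = 0 only n = 0 is allowed.\<close>

lemma dyad_power_ge:
  assumes "n < 2 ^ j"
  shows "1 / 4 \<le> dyad j ^ n"
proof (cases j)
  case 0
  then show ?thesis using assms by simp
next
  case (Suc i)
  have "1 / 4 \<le> dyad (Suc i) ^ (2 ^ Suc i)"
  proof (induction i)
    case 0
    show ?case by (simp add: dyad_def power2_eq_square)
  next
    case (Suc i)
    have "dyad (Suc i) \<le> dyad (Suc (Suc i)) ^ 2"
    proof -
      have "((1 + dyad (Suc i)) / 2)\<^sup>2 - dyad (Suc i) = ((1 - dyad (Suc i)) / 2)\<^sup>2"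
        by (simp add: power2_eq_square field_simps)
      also have "\<dots> \<ge> 0" by simp
      finally show ?thesis unfolding dyad_Suc[of "Suc i"] by simp
    qed
    then have "dyad (Suc i) ^ (2 ^ Suc i) \<le> (dyad (Suc (Suc i)) ^ 2) ^ (2 ^ Suc i)"
      by (intro power_mono) auto
    also have "\<dots> = dyad (Suc (Suc i)) ^ (2 ^ Suc (Suc i))"
      by (simp only: power_mult[symmetric] power_Suc[of 2 "Suc i"])
    finally show ?case using Suc by linarith
  qed
  also have "\<dots> \<le> dyad (Suc i) ^ n"
    using assms Suc by (intro power_decreasing) (auto intro: less_imp_le)
  finally show ?thesis using Suc by simp
qed

lemma dyadic_tail_le_moment:
  assumes sets: "{dyad j..<1} \<in> sets \<nu>" and n: "n < 2 ^ j"
  shows "emeasure \<nu> {dyad j..<1} \<le> 4 * (\<integral>\<^sup>+t. ennreal (t ^ n) * indicator {0..<1} t \<partial>\<nu>)"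
proof -
  have "emeasure \<nu> {dyad j..<1} = 4 * (\<integral>\<^sup>+t. ennreal (1/4) * indicator {dyad j..<1} t \<partial>\<nu>)"
  proof -
    have "ennreal 4 * ennreal (1/4) = ennreal (4 * (1/4))" by (rule ennreal_mult'[symmetric]) simp
    then have "(4::ennreal) * ennreal (1/4) = 1" by simp
    then have "4 * (ennreal (1/4) * emeasure \<nu> {dyad j..<1}) = emeasure \<nu> {dyad j..<1}"
      unfolding mult.assoc[symmetric] by simp
    then show ?thesis using sets by (simp add: nn_integral_cmult_indicator)
  qed
  also have "\<dots> \<le> 4 * (\<integral>\<^sup>+t. ennreal (t ^ n) * indicator {0..<1} t \<partial>\<nu>)"
  proof (intro mult_left_mono nn_integral_mono)
    fix t
    show "ennreal (1/4) * indicator {dyad j..<1} t \<le> ennreal (t ^ n) * indicator {0..<1} t"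
    proof (cases "dyad j \<le> t \<and> t < 1")
      case True
      then have "dyad j ^ n \<le> t ^ n" by (intro power_mono) auto
      then have "1/4 \<le> t ^ n" using dyad_power_ge[OF n] by linarith
      moreover have "0 \<le> t" using True dyad_range(1)[of j] by linarith
      ultimately show ?thesis using True by (simp add: ennreal_leI)
    qed auto
  qed simp
  finally show ?thesis .
qed

section \<open>Oscillation and the spaces BMOA and Bloch\<close>

lemma continuous_on_circle:
  assumes "h holomorphic_on unit_disc" "0 \<le> r" "r < 1"
  shows "continuous_on A (\<lambda>\<theta>. h (rcis r \<theta>))"
proof (rule continuous_on_compose2[OF holomorphic_on_imp_continuous_on[OF assms(1)]])
  show "continuous_on A (\<lambda>\<theta>. rcis r \<theta>)"
    unfolding rcis_def by (intro continuous_intros)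
qed (use assms in auto)

lemma has_integral_circle_mean:
  fixes h :: "complex \<Rightarrow> complex"
  assumes h: "h holomorphic_on unit_disc" and r: "0 \<le> r" "r < 1"
  shows "((\<lambda>\<theta>. h (rcis r \<theta>)) has_integral 2 * pi * h 0) {0..2 * pi}"
proof (cases "r = 0")
  case True
  have "((\<lambda>\<theta>. h 0) has_integral (2 * pi - 0) *\<^sub>R h 0) {0..2 * pi}"
    using has_integral_const_real[of "h 0" 0 "2 * pi"] by simp
  then show ?thesis using True by (simp add: scaleR_conv_of_real)
next
  case False
  then have r0: "0 < r" using r by simp
  have "((\<lambda>u. h u / (u - 0)) has_contour_integral (2 * of_real pi * \<i> * h 0)) (circlepath 0 r)"
    using h r r0 by (intro Cauchy_integral_circlepath_simple) (auto intro: holomorphic_on_subset)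
  then have "((\<lambda>t. h (0 + r * cis t) / (0 + r * cis t - 0) * r * \<i> * cis t) has_integral (2 * of_real pi * \<i> * h 0)) {0..2 * pi}"
    unfolding circlepath_def by (subst (asm) has_contour_integral_part_circlepath_iff) auto
  then have "((\<lambda>t. (- \<i>) * (h (0 + r * cis t) / (0 + r * cis t - 0) * r * \<i> * cis t)) has_integral (- \<i>) * (2 * of_real pi * \<i> * h 0)) {0..2 * pi}"
    by (rule has_integral_mult_right)
  moreover have "(- \<i>) * (h (0 + r * cis t) / (0 + r * cis t - 0) * r * \<i> * cis t) = h (rcis r t)" for t
    using r0 by (simp add: rcis_def field_simps)
  moreover have "(- \<i>) * (2 * of_real pi * \<i> * h 0) = 2 * pi * h 0" by (simp add: field_simps)
  ultimately show ?thesis by (simp only:)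
qed

text \<open>The mean of h^2 over the circle is (h 0)^2 = 0, and its real part is the difference of
  the two sides.\<close>

lemma circle_mean_Re_eq_Im:
  assumes h: "h holomorphic_on unit_disc" and r: "0 \<le> r" "r < 1" and h0: "h 0 = 0"
  shows "integral {0..2 * pi} (\<lambda>\<theta>. (Re (h (rcis r \<theta>)))\<^sup>2) = integral {0..2 * pi} (\<lambda>\<theta>. (Im (h (rcis r \<theta>)))\<^sup>2)"
proof -
  have "((\<lambda>\<theta>. (h (rcis r \<theta>))\<^sup>2) has_integral 2 * pi * (h 0)\<^sup>2) {0..2 * pi}"
    using h r by (intro has_integral_circle_mean[of "\<lambda>z. (h z)\<^sup>2"] holomorphic_intros)
  from has_integral_linear[OF this bounded_linear_Re] h0
  have "((\<lambda>\<theta>. (Re (h (rcis r \<theta>)))\<^sup>2 - (Im (h (rcis r \<theta>)))\<^sup>2) has_integral 0) {0..2 * pi}"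
    by (simp add: o_def power2_eq_square)
  moreover have "(\<lambda>\<theta>. (Re (h (rcis r \<theta>)))\<^sup>2) integrable_on {0..2 * pi}"
    "(\<lambda>\<theta>. (Im (h (rcis r \<theta>)))\<^sup>2) integrable_on {0..2 * pi}"
    using continuous_on_circle[OF h r]
    by (auto intro!: integrable_continuous_interval continuous_intros)
  ultimately show ?thesis
    using integral_diff[of "\<lambda>\<theta>. (Re (h (rcis r \<theta>)))\<^sup>2" "{0..2 * pi}" "\<lambda>\<theta>. (Im (h (rcis r \<theta>)))\<^sup>2"]
    by (simp add: integral_unique)
qed

text \<open>Both logarithms in \<open>L\<close> have imaginary part in (-pi/2, pi/2), so Im
  \<open>L\<close> stays within pi, while Re \<open>L\<close> is the logarithm in the bound. The
  general self-map covers automorphisms, for the BMOA seminorm, and the identity, for membership in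
  \<open>H2\<close>. The constant comes from (1 + x)^2 \<le> 2 + 2 x^2.\<close>

lemma H2_norm_le_log_oscillation:
  assumes h: "h holomorphic_on unit_disc"
    and \<phi>: "\<phi> holomorphic_on unit_disc" "\<And>z. norm z < 1 \<Longrightarrow> norm (\<phi> z) < 1"
    and A: "0 \<le> A"
    and bound: "\<And>z. norm z < 1 \<Longrightarrow> norm (h z) \<le> A * (1 + \<bar>ln (norm (1 - \<phi> z) / norm (1 - \<phi> 0))\<bar>)"
  shows "H2_norm h \<le> ennreal (A * sqrt (2 + 2 * pi\<^sup>2))"
  unfolding H2_norm_def
proof (rule SUP_least)
  fix r :: real assume "r \<in> {0..<1}"
  then have r: "0 \<le> r" "r < 1" by auto
  define L where "L z = Ln (1 - \<phi> z) - Ln (1 - \<phi> 0)" for z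
  have Re_pos: "0 < Re (1 - \<phi> z)" if "norm z < 1" for z
    using \<phi>(2)[OF that] abs_Re_le_cmod[of "\<phi> z"] by simp
  then have nonpos: "1 - \<phi> z \<notin> \<real>\<^sub>\<le>\<^sub>0" if "norm z < 1" for z
    using that by (metis complex_nonpos_Reals_iff not_le)
  have L: "L holomorphic_on unit_disc"
    unfolding L_def[abs_def] using nonpos by (intro holomorphic_intros \<phi>) (auto simp: \<phi>)
  have L0: "L 0 = 0" by (simp add: L_def)
  have ImL: "\<bar>Im (L z)\<bar> \<le> pi" if "norm z < 1" for z
    using Re_Ln_pos_lt_imp[OF Re_pos[OF that]] Re_Ln_pos_lt_imp[OF Re_pos[of 0]] by (simp add: L_def)
  have ReL: "Re (L z) = ln (norm (1 - \<phi> z) / norm (1 - \<phi> 0))" if "norm z < 1" for z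
  proof -
    have "1 - \<phi> z \<noteq> 0" "1 - \<phi> 0 \<noteq> 0" using Re_pos[OF that] Re_pos[of 0] by auto
    then show ?thesis by (simp add: L_def ln_div)
  qed
  have cont: "continuous_on {0..2 * pi} (\<lambda>\<theta>. L (rcis r \<theta>))" "continuous_on {0..2 * pi} (\<lambda>\<theta>. h (rcis r \<theta>))"
    using continuous_on_circle L h r by auto
  have int_Im: "integral {0..2 * pi} (\<lambda>\<theta>. (Im (L (rcis r \<theta>)))\<^sup>2) \<le> integral {0..2 * pi} (\<lambda>\<theta>. pi\<^sup>2)"
  proof (rule integral_le)
    show "(\<lambda>\<theta>. (Im (L (rcis r \<theta>)))\<^sup>2) integrable_on {0..2 * pi}"
      using cont by (intro integrable_continuous_interval continuous_intros)
    show "(Im (L (rcis r \<theta>)))\<^sup>2 \<le> pi\<^sup>2" for \<theta>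
      using ImL[of "rcis r \<theta>"] r by (simp add: abs_le_square_iff[symmetric])
  qed (rule integrable_continuous_interval[OF continuous_on_const])
  have "integral {0..2 * pi} (\<lambda>\<theta>. (norm (h (rcis r \<theta>)))\<^sup>2)
     \<le> integral {0..2 * pi} (\<lambda>\<theta>. A\<^sup>2 * (2 + 2 * (Re (L (rcis r \<theta>)))\<^sup>2))"
  proof (rule integral_le)
    show "(\<lambda>\<theta>. (norm (h (rcis r \<theta>)))\<^sup>2) integrable_on {0..2 * pi}"
      "(\<lambda>\<theta>. A\<^sup>2 * (2 + 2 * (Re (L (rcis r \<theta>)))\<^sup>2)) integrable_on {0..2 * pi}"
      using cont by (auto intro!: integrable_continuous_interval continuous_intros)
    fix \<theta>
    let ?x = "\<bar>Re (L (rcis r \<theta>))\<bar>"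
    have "norm (h (rcis r \<theta>)) \<le> A * (1 + ?x)"
      using bound[of "rcis r \<theta>"] r ReL[of "rcis r \<theta>"] by simp
    then have "(norm (h (rcis r \<theta>)))\<^sup>2 \<le> (A * (1 + ?x))\<^sup>2" by (intro power_mono) auto
    also have "\<dots> = A\<^sup>2 * (1 + ?x)\<^sup>2" by (simp add: power_mult_distrib)
    also have "(1 + ?x)\<^sup>2 \<le> 2 + 2 * ?x\<^sup>2"
      using sum_squares_bound[of 1 ?x] by (simp add: power2_sum)
    finally show "(norm (h (rcis r \<theta>)))\<^sup>2 \<le> A\<^sup>2 * (2 + 2 * (Re (L (rcis r \<theta>)))\<^sup>2)"
      by (simp add: mult_left_mono)
  qed
  also have "\<dots> = A\<^sup>2 * (2 * (2 * pi) + 2 * integral {0..2 * pi} (\<lambda>\<theta>. (Re (L (rcis r \<theta>)))\<^sup>2))"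
  proof -
    have "(\<lambda>\<theta>. 2 * (Re (L (rcis r \<theta>)))\<^sup>2) integrable_on {0..2 * pi}"
      using cont by (intro integrable_continuous_interval continuous_intros)
    then have "integral {0..2 * pi} (\<lambda>\<theta>. 2 + 2 * (Re (L (rcis r \<theta>)))\<^sup>2)
      = integral {0..2 * pi} (\<lambda>\<theta>. 2) + integral {0..2 * pi} (\<lambda>\<theta>. 2 * (Re (L (rcis r \<theta>)))\<^sup>2)"
      by (intro integral_add) auto
    then show ?thesis by simp
  qed
  also have "\<dots> \<le> A\<^sup>2 * (2 * (2 * pi) + 2 * (2 * pi * pi\<^sup>2))"
    using int_Im unfolding circle_mean_Re_eq_Im[OF L r L0]
    by (intro mult_left_mono add_left_mono) auto
  also have "\<dots> = (2 * pi) * (A\<^sup>2 * (2 + 2 * pi\<^sup>2))" by (simp add: algebra_simps)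
  finally have "1 / (2 * pi) * integral {0..2 * pi} (\<lambda>\<theta>. (norm (h (rcis r \<theta>)))\<^sup>2) \<le> A\<^sup>2 * (2 + 2 * pi\<^sup>2)"
    by (simp add: field_simps)
  then have "sqrt (1 / (2 * pi) * integral {0..2 * pi} (\<lambda>\<theta>. (norm (h (rcis r \<theta>)))\<^sup>2)) \<le> sqrt (A\<^sup>2 * (2 + 2 * pi\<^sup>2))"
    by (rule real_sqrt_le_mono)
  also have "\<dots> = A * sqrt (2 + 2 * pi\<^sup>2)" using A by (simp add: real_sqrt_mult)
  finally show "ennreal (sqrt (1 / (2 * pi) * integral {0..2 * pi} (\<lambda>\<theta>. (norm (h (rcis r \<theta>)))\<^sup>2)))
    \<le> ennreal (A * sqrt (2 + 2 * pi\<^sup>2))" by (rule ennreal_leI)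
qed

text \<open>The quotient g(z) / z extends to 0 with value g'(0). Applying the mean value property to
  its square bounds |g'(0)|^2 at once by the mean of |g|^2 / r^2, without Cauchy-Schwarz; then r
  tends to 1.\<close>

lemma norm_deriv_le_H2_norm:
  assumes g: "g holomorphic_on unit_disc" and g0: "g 0 = 0"
  shows "ennreal (norm (deriv g 0)) \<le> H2_norm g"
proof (cases "H2_norm g")
  case (real H)
  have "norm (deriv g 0) \<le> H"
  proof (rule field_le_mult_one_interval)
    fix r :: real assume r: "0 < r" "r < 1"
    define q where "q z = (if z = 0 then deriv g 0 else (g z - g 0) / (z - 0))" for z
    have q: "q holomorphic_on unit_disc"
      unfolding q_def using g by (intro pole_lemma_open) auto
    have "((\<lambda>\<theta>. (q (rcis r \<theta>))\<^sup>2) has_integral 2 * pi * (q 0)\<^sup>2) {0..2 * pi}"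
      using q r by (intro has_integral_circle_mean[of "\<lambda>z. (q z)\<^sup>2"] holomorphic_intros) auto
    then have "norm (2 * pi * (q 0)\<^sup>2) = norm (integral {0..2 * pi} (\<lambda>\<theta>. (q (rcis r \<theta>))\<^sup>2))"
      by (simp add: integral_unique)
    also have "\<dots> \<le> integral {0..2 * pi} (\<lambda>\<theta>. (norm (g (rcis r \<theta>)))\<^sup>2 / r\<^sup>2)"
    proof (rule integral_norm_bound_integral)
      have cont: "continuous_on {0..2 * pi} (\<lambda>\<theta>. q (rcis r \<theta>))" "continuous_on {0..2 * pi} (\<lambda>\<theta>. g (rcis r \<theta>))"
        using continuous_on_circle q g r by auto
      show "(\<lambda>\<theta>. (q (rcis r \<theta>))\<^sup>2) integrable_on {0..2 * pi}"
        "(\<lambda>\<theta>. (norm (g (rcis r \<theta>)))\<^sup>2 / r\<^sup>2) integrable_on {0..2 * pi}"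
        using cont r by (auto intro!: integrable_continuous_interval continuous_intros)
      show "norm ((q (rcis r \<theta>))\<^sup>2) \<le> (norm (g (rcis r \<theta>)))\<^sup>2 / r\<^sup>2" for \<theta>
        using r g0 by (auto simp: q_def norm_power norm_divide power_divide)
    qed
    also have "\<dots> = integral {0..2 * pi} (\<lambda>\<theta>. (norm (g (rcis r \<theta>)))\<^sup>2) / r\<^sup>2" by simp
    finally have "(r * norm (deriv g 0))\<^sup>2 \<le> 1 / (2 * pi) * integral {0..2 * pi} (\<lambda>\<theta>. (norm (g (rcis r \<theta>)))\<^sup>2)"
      using r by (simp add: q_def norm_mult norm_power field_simps)
    then have "r * norm (deriv g 0) \<le> sqrt (1 / (2 * pi) * integral {0..2 * pi} (\<lambda>\<theta>. (norm (g (rcis r \<theta>)))\<^sup>2))"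
      by (rule real_le_rsqrt)
    then have "ennreal (r * norm (deriv g 0)) \<le> ennreal (sqrt (1 / (2 * pi) * integral {0..2 * pi} (\<lambda>\<theta>. (norm (g (rcis r \<theta>)))\<^sup>2)))"
      by (rule ennreal_leI)
    also have "\<dots> \<le> H2_norm g" unfolding H2_norm_def using r by (intro SUP_upper) auto
    finally show "r * norm (deriv g 0) \<le> H" using real by simp
  qed
  then show ?thesis using real by (simp add: ennreal_leI)
qed simp

section \<open>Disc automorphisms, and BMOA inside the Bloch space\<close>

lemma disc_aut_eq_Moebius: "disc_aut a = (\<lambda>z. - Moebius_function 0 a z)"
  by (auto simp: disc_aut_def Moebius_function_simple minus_divide_left)

lemma norm_disc_aut_less_1: "norm a < 1 \<Longrightarrow> norm z < 1 \<Longrightarrow> norm (disc_aut a z) < 1"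
  by (simp add: disc_aut_eq_Moebius Moebius_function_norm_lt_1)

lemma disc_aut_holomorphic: "norm a < 1 \<Longrightarrow> disc_aut a holomorphic_on unit_disc"
  unfolding disc_aut_eq_Moebius by (intro holomorphic_intros Moebius_function_holomorphic)

lemma disc_aut_0 [simp]: "disc_aut a 0 = a"
  by (simp add: disc_aut_def)

lemma disc_aut_compose_holomorphic:
  assumes "f holomorphic_on unit_disc" "norm a < 1"
  shows "(\<lambda>z. f (disc_aut a z) - f a) holomorphic_on unit_disc"
proof -
  have "(f \<circ> disc_aut a) holomorphic_on unit_disc"
    using assms norm_disc_aut_less_1 by (intro holomorphic_on_compose_gen[OF disc_aut_holomorphic]) auto
  then show ?thesis by (intro holomorphic_intros) (simp add: o_def)
qed

lemma deriv_disc_aut_compose: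
  assumes f: "f holomorphic_on unit_disc" and a: "norm a < 1"
  shows "deriv (\<lambda>z. f (disc_aut a z) - f a) 0 = - (deriv f a * (1 - (norm a)\<^sup>2))"
proof (rule DERIV_imp_deriv)
  have aut: "(disc_aut a has_field_derivative (- (1 - (norm a)\<^sup>2))) (at 0)"
    unfolding disc_aut_def[abs_def]
    by (auto intro!: derivative_eq_intros simp: complex_norm_square[symmetric] algebra_simps)
  have "(f has_field_derivative deriv f a) (at (disc_aut a 0))"
    using f a by (auto intro: holomorphic_derivI)
  from DERIV_chain2[OF this aut] show "((\<lambda>z. f (disc_aut a z) - f a) has_field_derivative - (deriv f a * (1 - (norm a)\<^sup>2))) (at 0)"
    by (auto intro!: derivative_eq_intros simp: right_diff_distrib)
qed

text \<open>The automorphism has derivative -(1 - |a|^2) at 0, so each Bloch quotient is the modulus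
  of the derivative at 0 of a recentred function, to which \<open>norm_deriv_le_H2_norm\<close>
  applies.\<close>

lemma Bloch_norm_le_BMOA_norm:
  assumes "f holomorphic_on unit_disc"
  shows "Bloch_norm f \<le> BMOA_norm f"
  unfolding Bloch_norm_def BMOA_norm_def
proof (intro add_left_mono SUP_mono)
  fix a assume "a \<in> unit_disc"
  then have a: "norm a < 1" by simp
  have "(norm a)\<^sup>2 < 1" using a by (simp add: power_less_one_iff)
  then have "norm (complex_of_real (1 - (norm a)\<^sup>2)) = 1 - (norm a)\<^sup>2"
    unfolding norm_of_real by simp
  then have "norm (deriv f a) * (1 - (norm a)\<^sup>2) = norm (deriv (\<lambda>z. f (disc_aut a z) - f a) 0)"
    unfolding deriv_disc_aut_compose[OF assms a] by (simp only: norm_minus_cancel norm_mult of_real_diff of_real_1 of_real_power)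
  then have "ennreal (norm (deriv f a) * (1 - (norm a)\<^sup>2)) \<le> H2_norm (\<lambda>z. f (disc_aut a z) - f a)"
    using norm_deriv_le_H2_norm[OF disc_aut_compose_holomorphic[OF assms a]] by simp
  then show "\<exists>b\<in>unit_disc. ennreal (norm (deriv f a) * (1 - (norm a)\<^sup>2)) \<le> H2_norm (\<lambda>z. f (disc_aut b z) - f b)"
    using a by auto
qed

lemma BMOA_subset_Bloch: "BMOA \<subseteq> Bloch"
  using Bloch_norm_le_BMOA_norm by (auto simp: BMOA_def Bloch_def H2_def intro: le_less_trans)

text \<open>As \<open>disc_aut a 0 = a\<close>, the hypothesis with w = a is the bound required for
  the self-map \<open>disc_aut a\<close>.\<close>

lemma BMOA_if_log_oscillation:
  assumes f: "f holomorphic_on unit_disc" and A: "0 \<le> A"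
    and bound: "\<And>z w. norm z < 1 \<Longrightarrow> norm w < 1 \<Longrightarrow>
      norm (f z - f w) \<le> A * (1 + \<bar>ln (norm (1 - z) / norm (1 - w))\<bar>)"
  shows "f \<in> BMOA" "BMOA_norm f \<le> ennreal (norm (f 0) + A * sqrt (2 + 2 * pi\<^sup>2))"
proof -
  have "H2_norm (\<lambda>z. f (disc_aut a z) - f a) \<le> ennreal (A * sqrt (2 + 2 * pi\<^sup>2))" if "norm a < 1" for a
    using that f A bound[of "disc_aut a _" a] norm_disc_aut_less_1
    by (intro H2_norm_le_log_oscillation[where \<phi> = "disc_aut a"] disc_aut_compose_holomorphic disc_aut_holomorphic) auto
  then have "(SUP a\<in>unit_disc. H2_norm (\<lambda>z. f (disc_aut a z) - f a)) \<le> ennreal (A * sqrt (2 + 2 * pi\<^sup>2))"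
    by (intro SUP_least) simp
  then show le: "BMOA_norm f \<le> ennreal (norm (f 0) + A * sqrt (2 + 2 * pi\<^sup>2))"
    unfolding BMOA_norm_def using A by (subst ennreal_plus) (auto intro: add_left_mono)
  \<comment> \<open>\<open>BMOA\<close> also demands membership in \<open>H2\<close>, obtained from
    the identity as self-map. Nothing is subtracted from \<open>f\<close> here, so
    \<open>norm (f 0)\<close> enters the factor.\<close>
  have "H2_norm f \<le> ennreal ((norm (f 0) + A) * sqrt (2 + 2 * pi\<^sup>2))"
  proof (rule H2_norm_le_log_oscillation[where \<phi> = "\<lambda>z. z", OF f])
    fix z :: complex assume "norm z < 1"
    then have "norm (f z - f 0) \<le> A * (1 + \<bar>ln (norm (1 - z) / norm (1 - 0 :: complex))\<bar>)"
      by (intro bound) auto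
    then show "norm (f z) \<le> (norm (f 0) + A) * (1 + \<bar>ln (norm (1 - z) / norm (1 - 0 :: complex))\<bar>)"
      using norm_triangle_sub[of "f z" "f 0"]
        mult_left_mono[of 1 "1 + \<bar>ln (norm (1 - z) / norm (1 - 0 :: complex))\<bar>" "norm (f 0)"]
      unfolding distrib_right[of "norm (f 0)" A] by simp
  qed (use A in auto)
  also have "\<dots> < \<infinity>" by simp
  finally show "f \<in> BMOA"
    using le f by (auto simp: BMOA_def H2_def intro: le_less_trans)
qed

section \<open>The kernel of a doubling weight\<close>

lemma power_series_disc:
  fixes a :: "nat \<Rightarrow> complex"
  assumes "\<And>z. norm z < 1 \<Longrightarrow> summable (\<lambda>n. a n * z ^ n)"
  shows "(\<lambda>z. \<Sum>n. a n * z ^ n) holomorphic_on unit_disc"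
    and "\<And>z. norm z < 1 \<Longrightarrow> deriv (\<lambda>z. \<Sum>n. a n * z ^ n) z = (\<Sum>n. diffs a n * z ^ n)"
proof -
  have *: "((\<lambda>z. \<Sum>n. a n * z ^ n) has_field_derivative (\<Sum>n. diffs a n * z ^ n)) (at z)" if "norm z < 1" for z
    using assms that by (rule termdiffs_strong')
  then show "\<And>z. norm z < 1 \<Longrightarrow> deriv (\<lambda>z. \<Sum>n. a n * z ^ n) z = (\<Sum>n. diffs a n * z ^ n)"
    by (rule DERIV_imp_deriv)
  show "(\<lambda>z. \<Sum>n. a n * z ^ n) holomorphic_on unit_disc"
    unfolding holomorphic_on_open[OF open_ball] using * by (meson mem_ball_0)
qed

lemma one_minus_exp_ge:
  fixes x :: real
  assumes "0 \<le> x" "x \<le> 1"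
  shows "x / 2 \<le> 1 - exp (- x)"
proof -
  have "exp (- x) \<le> 1 / (1 + x)"
    using exp_ge_add_one_self[of x] assms by (simp add: exp_minus field_simps)
  also have "\<dots> \<le> 1 - x / 2"
    using assms mult_right_mono[of x 1 x] by (simp add: field_simps)
  finally show ?thesis by simp
qed

text \<open>Passing from 1 - t z to 1 - z costs at most 1 - t, which is itself at most |1 - t z|
  because |t z| \<le> t.\<close>

lemma norm_one_minus_le_twice:
  fixes z :: complex
  assumes "norm z \<le> 1" "0 \<le> t" "t \<le> 1"
  shows "norm (1 - z) \<le> 2 * norm (1 - of_real t * z)"
proof -
  have "1 - t \<le> 1 - norm (of_real t * z)"
    using assms mult_left_mono[of "norm z" 1 t] by (simp add: norm_mult)
  also have "\<dots> \<le> norm (1 - of_real t * z)"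
    using norm_triangle_ineq2[of 1 "of_real t * z"] by simp
  finally have 1: "1 - t \<le> norm (1 - of_real t * z)" .
  have "norm (1 - z) = norm ((1 - of_real t * z) - of_real (1 - t) * z)"
    by (simp add: algebra_simps)
  also have "\<dots> \<le> norm (1 - of_real t * z) + norm (of_real (1 - t) * z)"
    by (rule norm_triangle_ineq4)
  also have "norm (of_real (1 - t) * z) \<le> 1 - t"
    using assms mult_left_mono[of "norm z" 1 "1 - t"] unfolding norm_mult norm_of_real by simp
  finally show ?thesis using 1 by linarith
qed

lemma ex_dyadic_scale:
  fixes x :: real
  assumes "0 < x" "x \<le> 2"
  obtains j :: nat where "(1/2) ^ j < x" "x \<le> 2 * (1/2) ^ j"
proof -
  define j where "j = (LEAST j::nat. (1/2) ^ j < x)"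
  have ex: "\<exists>j::nat. (1/2) ^ j < x" using assms real_arch_pow_inv[of x "1/2"] by simp
  have 1: "(1/2) ^ j < x" unfolding j_def using ex by (rule LeastI_ex)
  have "x \<le> 2 * (1/2) ^ j"
  proof (cases j)
    case 0
    then show ?thesis using assms by simp
  next
    case (Suc i)
    have "\<not> (1/2) ^ i < x" using not_less_Least[of i "\<lambda>j. (1/2) ^ j < x"] Suc unfolding j_def by simp
    then show ?thesis using Suc by simp
  qed
  with 1 show ?thesis by (rule that)
qed

text \<open>The number of dyadic scales between \<open>\<rho>\<close> and \<open>\<sigma>\<close> is logarithmic; outside
  of them the terms decay geometrically.\<close>

lemma suminf_two_sided_decay:
  fixes \<rho> \<sigma> :: real
  assumes \<rho>: "0 < \<rho>" "\<rho> \<le> \<sigma>" and \<sigma>: "\<sigma> \<le> 2"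
  defines "\<psi> \<equiv> \<lambda>k. min 1 (min (2 ^ Suc k * \<sigma>) ((1/2) ^ k / \<rho>))"
  shows "summable \<psi>" "suminf \<psi> \<le> 7 * (1 + ln (\<sigma> / \<rho>))"
proof -
  obtain j where j: "(1/2) ^ j < \<sigma>" "\<sigma> \<le> 2 * (1/2) ^ j" using ex_dyadic_scale[of \<sigma>] assms by auto
  obtain l where l: "(1/2) ^ l < \<rho>" "\<rho> \<le> 2 * (1/2) ^ l" using ex_dyadic_scale[of \<rho>] assms by auto
  have \<psi>0: "0 \<le> \<psi> k" for k using assms by (simp add: \<psi>_def)
  have "\<psi> (k + l) \<le> (1/2) ^ k" for k
  proof -
    have "\<psi> (k + l) \<le> (1/2) ^ (k + l) / \<rho>" by (simp add: \<psi>_def)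
    also have "\<dots> = (1/2) ^ k * ((1/2) ^ l / \<rho>)" by (simp add: power_add)
    also have "\<dots> \<le> (1/2) ^ k * 1" using l \<rho> by (intro mult_left_mono) auto
    finally show ?thesis by simp
  qed
  then have le: "\<psi> (k + l) \<le> (1/2) ^ k" for k .
  have geo: "summable (\<lambda>k. (1/2::real) ^ k)" by (rule summable_geometric) simp
  have tail_sm: "summable (\<lambda>k. \<psi> (k + l))"
    by (rule summable_comparison_test[OF _ geo]) (use le \<psi>0 in auto)
  have tail: "(\<Sum>k. \<psi> (k + l)) \<le> (\<Sum>k. (1/2) ^ k)"
    using le tail_sm geo by (rule suminf_le)
  show sm: "summable \<psi>" using tail_sm by (simp add: summable_iff_shift)
  \<comment> \<open>The entries 2^(k+1) \<sigma> grow geometrically, so a partial sum is comparable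
    to its last term; at i = j the bound is 4.\<close>
  have head: "(\<Sum>k<i. \<psi> k) \<le> 4 * 2 ^ i * (1/2) ^ j" for i
  proof (induction i)
    case (Suc i)
    have "\<psi> i \<le> 2 ^ Suc i * \<sigma>" by (simp add: \<psi>_def)
    also have "\<dots> \<le> 2 ^ Suc i * (2 * (1/2) ^ j)" using j by (intro mult_left_mono) auto
    finally show ?case using Suc by simp
  qed simp
  \<comment> \<open>Between the two scales each term is at most 1. If \<open>l \<le> j\<close> there
    is no such range and the truncated difference \<open>l - j\<close> is 0.\<close>
  have "(\<Sum>k<l. \<psi> k) \<le> (\<Sum>k<min l j. \<psi> k) + real (l - j)"
  proof (cases "l \<le> j")
    case False
    then have "(\<Sum>k<l. \<psi> k) = (\<Sum>k<j. \<psi> k) + (\<Sum>k=j..<l. \<psi> k)"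
      by (simp add: lessThan_atLeast0 sum.atLeastLessThan_concat)
    also have "(\<Sum>k=j..<l. \<psi> k) \<le> (\<Sum>k=j..<l. 1)" by (intro sum_mono) (simp add: \<psi>_def)
    finally show ?thesis using False by (simp add: min_def)
  qed (simp add: min_def)
  also have "(\<Sum>k<min l j. \<psi> k) \<le> (\<Sum>k<j. \<psi> k)"
    using \<psi>0 by (intro sum_mono2) auto
  also have "\<dots> \<le> 4" using head[of j] by (simp add: power_divide)
  finally have 1: "(\<Sum>k<l. \<psi> k) \<le> 4 + real (l - j)" by simp
  have 2: "real (l - j) \<le> 1 + 2 * ln (\<sigma> / \<rho>)"
  proof (cases "l \<le> j")
    case False
    have "2 ^ (l - j) * (1/2) ^ l = (1/2::real) ^ j"
      using False by (simp add: power_divide power_diff)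
    also have "\<dots> \<le> \<sigma>" using j by simp
    finally have "2 ^ (l - j) * (1/2) ^ l \<le> \<sigma>" .
    moreover have "2 ^ (l - j) * (\<rho> / 2) \<le> 2 ^ (l - j) * (1/2) ^ l"
      using l by (intro mult_left_mono) auto
    ultimately have "2 ^ (l - j) * (\<rho> / 2) \<le> \<sigma>" by linarith
    then have "2 ^ (l - j) \<le> 2 * (\<sigma> / \<rho>)" using \<rho> by (simp add: field_simps)
    then have "ln (2 ^ (l - j)) \<le> ln (2 * (\<sigma> / \<rho>))" using assms by (intro ln_mono) auto
    also have "ln (2 * (\<sigma> / \<rho>)) = ln 2 + ln (\<sigma> / \<rho>)" using assms by (subst ln_mult) auto
    finally have "real (l - j) * ln 2 \<le> ln 2 + ln (\<sigma> / \<rho>)" by (simp add: ln_realpow)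
    then have "real (l - j) - 1 \<le> ln (\<sigma> / \<rho>) / ln 2" by (simp add: field_simps)
    also have "\<dots> \<le> ln (\<sigma> / \<rho>) / (1/2)"
      using assms ln2_ge_two_thirds by (intro divide_left_mono) auto
    finally show ?thesis by simp
  qed (use assms in simp)
  have "suminf \<psi> = (\<Sum>k. \<psi> (k + l)) + (\<Sum>k<l. \<psi> k)"
    using sm by (rule suminf_split_initial_segment)
  \<comment> \<open>2 for the geometric tail, 4 for the head, 1 for rounding the number of scales;
    the sum 7 also covers the factor 2 of the logarithm.\<close>
  also have "\<dots> \<le> 2 + (4 + (1 + 2 * ln (\<sigma> / \<rho>)))"
    using tail 1 2 suminf_geometric[of "1/2::real"] by simp
  also have "\<dots> \<le> 7 * (1 + ln (\<sigma> / \<rho>))" using assms by simp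
  finally show "suminf \<psi> \<le> 7 * (1 + ln (\<sigma> / \<rho>))" .
qed

text \<open>The kernel estimates depend on the weight only through these facts about tails
  \<open>W\<close> and moments \<open>m\<close>. The comparison of \<open>m\<close> with
  \<open>W\<close> is one-sided; the reverse one appears as the hypothesis \<open>upper\<close>
  where it is wanted.\<close>

locale doubling_weight =
  fixes W :: "real \<Rightarrow> real" and m :: "nat \<Rightarrow> real" and C :: real
  assumes C: "1 \<le> C"
    and W_pos: "0 \<le> r \<Longrightarrow> r < 1 \<Longrightarrow> 0 < W r"
    and W_antimono: "0 \<le> r \<Longrightarrow> r \<le> s \<Longrightarrow> s < 1 \<Longrightarrow> W s \<le> W r"
    and W_doubling: "0 \<le> r \<Longrightarrow> r < 1 \<Longrightarrow> W r \<le> C * W ((1 + r) / 2)"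
    and m_antimono: "n \<le> k \<Longrightarrow> m k \<le> m n"
    and W_dyad_le_m: "n < 2 ^ j \<Longrightarrow> W (dyad j) \<le> 4 * m n"
begin

lemma W_dyad_pos: "0 < W (dyad k)"
  by (rule W_pos) auto

lemma W_dyad_le: "W (dyad k) \<le> C ^ i * W (dyad (k + i))"
proof (induction i)
  case (Suc i)
  have "C ^ i * W (dyad (k + i)) \<le> C ^ i * (C * W (dyad (k + Suc i)))"
    using W_doubling[of "dyad (k + i)"] C unfolding add_Suc_right dyad_Suc by (intro mult_left_mono) auto
  with Suc show ?case by (simp add: mult_ac)
qed simp

lemma m_pos: "0 < m n"
proof -
  have "0 < W (dyad n)" by (rule W_dyad_pos)
  also have "\<dots> \<le> 4 * m n" using less_exp by (rule W_dyad_le_m)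
  finally show ?thesis by simp
qed

definition c :: "nat \<Rightarrow> real" where "c n = 1 / (2 * m (2 * n + 1))"

lemma c_pos: "0 < c n"
  using m_pos by (simp add: c_def)

lemma c_mono: "n \<le> k \<Longrightarrow> c n \<le> c k"
  unfolding c_def using m_pos by (intro divide_left_mono mult_left_mono m_antimono mult_pos_pos) auto

definition coeff_const :: real where
  "coeff_const = 2 * C ^ 3 * growth_const C * exp 1"

lemma coeff_const_pos: "0 < coeff_const"
  using C growth_const_pos[of C] by (simp add: coeff_const_def)

text \<open>By doubling, \<open>c n\<close> grows at most like a power of n 2^-k relative to 1 /
  \<open>W (dyad k)\<close>. The exponential form costs only half of the decay in
  \<open>dyad k ^ n\<close> \<le> exp (- n 2^-k), so that summation over n still meets a geometric
  series.\<close>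

lemma c_le: "c n \<le> coeff_const / W (dyad k) * exp (real n * (1/2) ^ k / 2)"
proof -
  obtain i where i: "2 ^ i \<le> 2 * n + 2" "2 * n + 2 < 2 ^ Suc i"
    using ex_power_ivl1[of 2 "2 * n + 2"] by auto
  \<comment> \<open>The number of doublings from \<open>dyad k\<close> to the scale of the moment of
    order 2 n + 1. Truncation to 0 covers the case that \<open>dyad k\<close> lies beyond that
    scale, where monotonicity suffices.\<close>
  define l where "l = Suc i - k"
  have "W (dyad k) \<le> C ^ l * W (dyad (Suc i))"
  proof (cases "k \<le> Suc i")
    case True
    then show ?thesis using W_dyad_le[of k l] by (simp add: l_def)
  next
    case False
    then show ?thesis by (simp add: l_def W_antimono dyad_mono)
  qed
  also have "W (dyad (Suc i)) \<le> 4 * m (2 * n + 1)" using i by (intro W_dyad_le_m) simp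
  finally have "W (dyad k) \<le> C ^ l * (4 * m (2 * n + 1))" using C by (simp add: mult_left_mono)
  then have "c n \<le> 2 * C ^ l / W (dyad k)"
    using m_pos[of "2 * n + 1"] W_dyad_pos[of k] by (simp add: c_def field_simps)
  \<comment> \<open>Up to additive constants 2^l is at most 4 n 2^-k, so
    \<open>growth_term_le\<close> at \<open>l\<close> itself could cost exp (n 2^-k), the whole
    decay of \<open>dyad k ^ n\<close>. Splitting off three doublings divides this exponent by
    8.\<close>
  also have "C ^ l \<le> C ^ 3 * (growth_const C * exp (1/4 + 2 ^ l / 32))"
  proof -
    have "C ^ l \<le> C ^ (3 + (l - 3))" using C by (intro power_increasing) auto
    also have "\<dots> = C ^ 3 * C ^ (l - 3)" by (rule power_add)
    also have "C ^ (l - 3) \<le> growth_const C * exp (2 ^ (l - 3) / 4)"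
      using growth_term_le[of C "l - 3"] C by (simp add: exp_minus field_simps)
    also have "\<dots> \<le> growth_const C * exp (1/4 + 2 ^ l / 32)"
    proof -
      have "(2::real) ^ (l - 3) \<le> 1 + 2 ^ l / 8"
        by (cases "l \<le> 3") (auto simp: power_diff)
      then show ?thesis using growth_const_pos[of C] C by (intro mult_left_mono) auto
    qed
    finally show ?thesis using C by (simp add: mult_left_mono)
  qed
  also have "exp (1/4 + 2 ^ l / 32) \<le> exp (1 + real n * (1/2) ^ k / 2)"
  proof -
    have "(2::real) ^ l \<le> 4 * (real n + 1) * (1/2) ^ k + 1"
    proof (cases "k \<le> Suc i")
      case True
      have "(2::real) ^ i \<le> 2 * real n + 2" using of_nat_mono[OF i(1), where ?'a = real] by simp
      then have "(2::real) ^ Suc i * (1/2) ^ k \<le> 4 * (real n + 1) * (1/2) ^ k"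
        by (intro mult_right_mono) auto
      moreover have "(2::real) ^ l = 2 ^ Suc i * (1/2) ^ k"
        unfolding l_def using True by (simp only: power_diff power_divide) simp
      ultimately show ?thesis by linarith
    qed (simp add: l_def)
    also have "\<dots> \<le> 4 * (real n * (1/2) ^ k) + 5"
      using power_le_one[of "1/2::real" k] by (simp add: algebra_simps)
    finally have "(2::real) ^ l / 32 \<le> real n * (1/2) ^ k / 8 + 5/32" by simp
    moreover have "0 \<le> real n * (1/2) ^ k" by simp
    ultimately have "1/4 + (2::real) ^ l / 32 \<le> 1 + real n * (1/2) ^ k / 2" by linarith
    then show ?thesis by simp
  qed
  finally have "c n \<le> 2 * (C ^ 3 * (growth_const C * exp (1 + real n * (1/2) ^ k / 2))) / W (dyad k)"
    using C growth_const_pos[of C] W_dyad_pos[of k] by (simp add: divide_right_mono mult_left_mono)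
  then show ?thesis by (simp add: coeff_const_def exp_add mult_ac)
qed

definition Kr :: "real \<Rightarrow> real" where "Kr t = (\<Sum>n. c n * t ^ n)"

lemma Kr_dyad:
  shows "summable (\<lambda>n. c n * dyad k ^ n)" "Kr (dyad k) \<le> 4 * coeff_const * 2 ^ k / W (dyad k)"
proof -
  \<comment> \<open>The ratio that remains after the loss in \<open>c_le\<close>; 1 - q is
    comparable to 2^-k.\<close>
  define q where "q = exp (- ((1/2::real) ^ k / 2))"
  have q: "0 < q" "q < 1" by (simp_all add: q_def)
  have le: "c n * dyad k ^ n \<le> coeff_const / W (dyad k) * q ^ n" for n
  proof -
    have "dyad k ^ n \<le> exp (- (real n * (1/2) ^ k))"
      unfolding dyad_def by (rule one_minus_power_le_exp) (rule power_le_one, auto)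
    then have "c n * dyad k ^ n \<le> (coeff_const / W (dyad k) * exp (real n * (1/2) ^ k / 2)) * exp (- (real n * (1/2) ^ k))"
      using coeff_const_pos W_dyad_pos[of k] by (intro mult_mono c_le) auto
    also have "\<dots> = coeff_const / W (dyad k) * (exp (real n * (1/2) ^ k / 2) * exp (- (real n * (1/2) ^ k)))"
      by (simp only: mult.assoc)
    also have "exp (real n * (1/2) ^ k / 2) * exp (- (real n * (1/2) ^ k)) = q ^ n"
      unfolding q_def mult_exp_exp exp_of_nat_mult[symmetric] by (rule arg_cong[of _ _ exp]) simp
    finally show ?thesis .
  qed
  have sq: "summable (\<lambda>n. coeff_const / W (dyad k) * q ^ n)"
    using q by (intro summable_mult summable_geometric) auto
  show sm: "summable (\<lambda>n. c n * dyad k ^ n)"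
    by (rule summable_comparison_test[OF _ sq]) (use le c_pos in \<open>auto simp: abs_mult less_imp_le\<close>)
  have "Kr (dyad k) \<le> (\<Sum>n. coeff_const / W (dyad k) * q ^ n)"
    unfolding Kr_def using le sm sq by (intro suminf_le) auto
  also have "\<dots> = coeff_const / W (dyad k) * (1 / (1 - q))"
    using q by (subst suminf_mult) (auto simp: suminf_geometric summable_geometric)
  also have "1 / (1 - q) \<le> 4 * 2 ^ k"
  proof -
    have "(1/2::real) ^ k \<le> 1" by (rule power_le_one) auto
    then have "(1/2) ^ k / 2 / 2 \<le> 1 - q" unfolding q_def by (intro one_minus_exp_ge) auto
    then have "1 \<le> 4 * 2 ^ k * (1 - q)"
      using mult_left_mono[of "(1/2) ^ k / 2 / 2" "1 - q" "4 * 2 ^ k"] by (simp add: power_divide)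
    then show ?thesis using q by (simp add: field_simps)
  qed
  finally show "Kr (dyad k) \<le> 4 * coeff_const * 2 ^ k / W (dyad k)"
    using coeff_const_pos W_dyad_pos[of k] by (simp add: divide_right_mono mult_ac mult_left_mono)
qed

lemma summable_c:
  assumes "0 \<le> t" "t < 1"
  shows "summable (\<lambda>n. c n * t ^ n)"
proof -
  obtain k where k: "t < dyad k" using dyad_exceeds[OF assms(2)] by blast
  show ?thesis
  proof (rule summable_comparison_test[OF _ Kr_dyad(1)[of k]], intro exI allI impI)
    fix n
    show "norm (c n * t ^ n) \<le> c n * dyad k ^ n"
      using assms k c_pos[of n] by (simp add: abs_mult mult_left_mono power_mono)
  qed
qed

lemma Kr_mono: "0 \<le> s \<Longrightarrow> s \<le> t \<Longrightarrow> t < 1 \<Longrightarrow> Kr s \<le> Kr t"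
  unfolding Kr_def using c_pos
  by (intro suminf_le summable_c mult_left_mono power_mono) (auto intro: less_imp_le)

definition kap :: real where "kap = 8 * coeff_const * C"

lemma kap_pos: "0 < kap"
  using C coeff_const_pos by (simp add: kap_def)

lemma Kr_le:
  assumes "0 \<le> t" "t < 1"
  shows "Kr t \<le> kap / ((1 - t) * W t)"
proof -
  obtain k where k: "dyad k \<le> t" "t < dyad (Suc k)" using assms by (rule dyad_shell)
  have "W t \<le> W (dyad k)" using k assms by (intro W_antimono) auto
  also have "\<dots> \<le> C * W (dyad (Suc k))" using W_dyad_le[of k 1] by simp
  finally have W: "W t / C \<le> W (dyad (Suc k))" using C by (simp add: field_simps)
  have t: "(1 - t) * 2 ^ k \<le> 1"
    using k mult_right_mono[of "1 - t" "(1/2) ^ k" "2 ^ k"] by (simp add: dyad_def power_divide)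
  have "Kr t \<le> Kr (dyad (Suc k))" using k assms by (intro Kr_mono) auto
  also have "\<dots> \<le> 4 * coeff_const * 2 ^ Suc k / W (dyad (Suc k))" by (rule Kr_dyad)
  also have "\<dots> \<le> 4 * coeff_const * 2 ^ Suc k / (W t / C)"
    using W coeff_const_pos W_pos[OF assms] W_dyad_pos[of "Suc k"] C
    by (intro divide_left_mono mult_pos_pos) auto
  also have "\<dots> = kap / W t * 2 ^ k" by (simp add: kap_def)
  also have "\<dots> \<le> kap / W t * (1 / (1 - t))"
    using t assms kap_pos W_pos[OF assms] by (intro mult_left_mono) (auto simp: field_simps)
  finally show ?thesis by (simp add: mult_ac)
qed

definition K :: "complex \<Rightarrow> complex" where "K z = (\<Sum>n. complex_of_real (c n) * z ^ n)"

lemma summable_norm_K: "norm z < 1 \<Longrightarrow> summable (\<lambda>n. norm (complex_of_real (c n) * z ^ n))"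
  using summable_c[of "norm z"] c_pos by (simp add: norm_mult norm_power abs_of_pos)

lemma K_holomorphic: "K holomorphic_on unit_disc"
  unfolding K_def[abs_def] by (intro power_series_disc summable_norm_cancel[OF summable_norm_K])

lemma norm_K_le:
  assumes "norm z \<le> t" "t < 1"
  shows "norm (K z) \<le> Kr t"
proof -
  have z: "norm z < 1" using assms by simp
  have "norm (K z) \<le> Kr (norm z)"
    using summable_norm[OF summable_norm_K[OF z]] c_pos
    by (simp add: K_def Kr_def norm_mult norm_power abs_of_pos)
  also have "\<dots> \<le> Kr t" using assms by (intro Kr_mono) auto
  finally show ?thesis .
qed

text \<open>Multiplying by \<open>1 - z\<close> replaces the increasing coefficients by their nonnegative
  differences.\<close>

lemma norm_one_minus_mult_K_le:
  assumes "norm z \<le> t" "t < 1"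
  shows "norm ((1 - z) * K z) \<le> (1 - t) * Kr t"
proof -
  define d where "d n = c (Suc n) - c n" for n
  have d0: "0 \<le> d n" for n using c_mono[of n "Suc n"] by (simp add: d_def)
  \<comment> \<open>Stated over a general field so that it applies both at the complex
    \<open>z\<close> and at the real \<open>t\<close>, whose series dominates the first term by
    term.\<close>
  have diff: "(\<lambda>n. of_real (d n) * x ^ Suc n) sums ((1 - x) * S - of_real (c 0))"
    if "(\<lambda>n. of_real (c n) * x ^ n) sums S" for x S :: "'b::real_normed_field"
  proof -
    have "(\<lambda>n. of_real (c (Suc n)) * x ^ Suc n) sums (S - of_real (c 0))"
      using that by (subst sums_Suc_iff) simp
    moreover have "(\<lambda>n. x * (of_real (c n) * x ^ n)) sums (x * S)"
      using that by (rule sums_mult)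
    ultimately have "(\<lambda>n. of_real (c (Suc n)) * x ^ Suc n - x * (of_real (c n) * x ^ n)) sums (S - of_real (c 0) - x * S)"
      by (rule sums_diff)
    moreover have "of_real (c (Suc n)) * x ^ Suc n - x * (of_real (c n) * x ^ n) = of_real (d n) * x ^ Suc n" for n
      by (simp add: d_def algebra_simps)
    ultimately show ?thesis by (simp add: algebra_simps)
  qed
  have t: "0 \<le> t" using assms norm_ge_zero order_trans by blast
  have z: "norm z < 1" using assms by simp
  have K: "(\<lambda>n. of_real (d n) * z ^ Suc n) sums ((1 - z) * K z - of_real (c 0))"
    using summable_norm_cancel[OF summable_norm_K[OF z]] unfolding K_def by (intro diff summable_sums)
  have Kr: "(\<lambda>n. d n * t ^ Suc n) sums ((1 - t) * Kr t - c 0)"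
    using diff[of t "Kr t"] summable_sums[OF summable_c[OF t assms(2)]] by (simp add: Kr_def)
  have "norm (of_real (d n) * z ^ Suc n) \<le> d n * t ^ Suc n" for n
    unfolding norm_mult norm_power norm_of_real using d0[of n] assms(1)
    by (simp only: abs_of_nonneg) (intro mult_left_mono power_mono norm_ge_zero)
  then have "norm (\<Sum>n. of_real (d n) * z ^ Suc n) \<le> (\<Sum>n. d n * t ^ Suc n)"
    using Kr by (intro norm_suminf_le) (auto simp: sums_iff)
  then have "norm ((1 - z) * K z - of_real (c 0)) \<le> (1 - t) * Kr t - c 0"
    unfolding sums_unique[OF K, symmetric] sums_unique[OF Kr, symmetric] .
  moreover have "norm ((1 - z) * K z) \<le> norm ((1 - z) * K z - of_real (c 0)) + c 0"
    using norm_triangle_sub[of "(1 - z) * K z" "of_real (c 0)"] c_pos[of 0] by (simp add: add.commute)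
  ultimately show ?thesis by linarith
qed


section \<open>Products of a bounded function with the kernel\<close>

context
  fixes f :: "complex \<Rightarrow> complex" and B :: real
  assumes f: "f holomorphic_on unit_disc" and B: "\<And>z. norm z < 1 \<Longrightarrow> norm (f z) \<le> B"
begin

lemma B_nonneg: "0 \<le> B"
  using order_trans[OF norm_ge_zero B[of 0]] by simp

lemma fK_holomorphic: "(\<lambda>z. f z * K z) holomorphic_on unit_disc"
  using f K_holomorphic by (rule holomorphic_on_mult)

lemma norm_fK_le:
  assumes "norm z \<le> t" "t < 1"
  shows "norm (f z * K z) \<le> B * kap / ((1 - t) * W t)"
proof -
  have t: "0 \<le> t" using assms norm_ge_zero order_trans by blast
  have "norm (K z) \<le> kap / ((1 - t) * W t)"
    using norm_K_le[OF assms] Kr_le[OF t assms(2)] by linarith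
  then have "norm (f z) * norm (K z) \<le> B * (kap / ((1 - t) * W t))"
    using assms B_nonneg by (intro mult_mono B) auto
  then show ?thesis by (simp add: norm_mult)
qed

text \<open>Gains the factor (1 - t) / |1 - z| over \<open>norm_fK_le\<close>, at the price of a
  factor 2 for replacing 1 - z by 1 - t z.\<close>

lemma norm_fK_le':
  assumes z: "norm z < 1" and t: "0 \<le> t" "t < 1"
  shows "norm (f (of_real t * z) * K (of_real t * z)) * norm (1 - z) \<le> 2 * B * kap / W t"
proof -
  let ?u = "of_real t * z :: complex"
  have u: "norm ?u \<le> t" using z t mult_left_mono[of "norm z" 1 t] by (simp add: norm_mult)
  have "norm (K ?u) * norm (1 - z) \<le> norm (K ?u) * (2 * norm (1 - ?u))"
    using z t by (intro mult_left_mono norm_one_minus_le_twice) auto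
  also have "\<dots> = 2 * norm ((1 - ?u) * K ?u)" by (simp add: norm_mult)
  also have "\<dots> \<le> 2 * ((1 - t) * Kr t)"
    using norm_one_minus_mult_K_le[OF u t(2)] by simp
  also have "(1 - t) * Kr t \<le> kap / W t"
    using mult_left_mono[OF Kr_le[OF t], of "1 - t"] t by simp
  finally have *: "norm (K ?u) * norm (1 - z) \<le> 2 * (kap / W t)" by simp
  have "norm (f ?u) * (norm (K ?u) * norm (1 - z)) \<le> B * (2 * (kap / W t))"
    using * u t B_nonneg by (intro mult_mono[OF B]) auto
  then show ?thesis by (simp add: norm_mult mult_ac)
qed

text \<open>Cauchy's inequality on discs of radius (1 - t) / 2 about points of
  \<open>cball 0 t\<close>. They stay in the disc of radius R = (1 + t) / 2, which is where doubling
  compares \<open>W R\<close> with \<open>W t\<close>; convexity of \<open>cball 0 t\<close> turns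
  the derivative bound into a difference bound.\<close>

lemma norm_fK_diff_le:
  assumes z: "norm z < 1" "norm w < 1" and t: "0 \<le> t" "t < 1"
  shows "norm (f (of_real t * z) * K (of_real t * z) - f (of_real t * w) * K (of_real t * w))
    \<le> 4 * B * kap * C / ((1 - t)\<^sup>2 * W t) * norm (z - w)"
proof -
  let ?g = "\<lambda>z. f z * K z"
  define R where "R = (1 + t) / 2"
  have R: "0 \<le> R" "R < 1" "t < R" "1 - R = (1 - t) / 2" "R - t = (1 - t) / 2"
    using t by (auto simp: R_def field_simps)
  have WR: "W t / C \<le> W R" using W_doubling[OF t] C by (simp add: R_def field_simps)
  have gR: "norm (?g v) \<le> 2 * B * kap * C / ((1 - t) * W t)" if "norm v \<le> R" for v
  proof -
    have "norm (?g v) \<le> B * kap / ((1 - R) * W R)" using that R by (intro norm_fK_le) auto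
    also have "\<dots> \<le> B * kap / ((1 - t) / 2 * (W t / C))"
      unfolding R(4) using WR t C W_pos[OF t] W_pos[OF R(1,2)] B_nonneg kap_pos
      by (intro divide_left_mono mult_left_mono mult_pos_pos divide_pos_pos mult_nonneg_nonneg) auto
    finally show ?thesis by (simp add: mult_ac)
  qed
  have g': "norm (deriv ?g u) \<le> 4 * B * kap * C / ((1 - t)\<^sup>2 * W t)" if u: "u \<in> cball 0 t" for u
  proof -
    have sub: "norm v \<le> R" if "dist u v \<le> R - t" for v
      using that u norm_triangle_sub[of v u] by (simp add: dist_norm norm_minus_commute)
    then have sub': "cball u (R - t) \<subseteq> unit_disc"
    proof (intro subsetI)
      fix v assume "v \<in> cball u (R - t)"
      then have "norm v \<le> R" by (intro sub) simp
      then show "v \<in> unit_disc" using R(2) by simp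
    qed
    have "norm ((deriv ^^ 1) ?g u) \<le> fact 1 * (2 * B * kap * C / ((1 - t) * W t)) / (R - t) ^ 1"
    proof (rule Cauchy_inequality)
      show "?g holomorphic_on ball u (R - t)"
        using fK_holomorphic order_trans[OF ball_subset_cball sub'] by (rule holomorphic_on_subset)
      show "continuous_on (cball u (R - t)) ?g"
        using fK_holomorphic sub' by (intro holomorphic_on_imp_continuous_on) (rule holomorphic_on_subset)
      show "0 < R - t" using R by simp
      show "norm (?g v) \<le> 2 * B * kap * C / ((1 - t) * W t)" if "norm (u - v) = R - t" for v
        using that by (intro gR sub) (simp add: dist_norm)
    qed
    also have "\<dots> = 4 * B * kap * C / ((1 - t)\<^sup>2 * W t)"
      unfolding R(5) by (simp add: power2_eq_square mult_ac)
    finally show ?thesis by simp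
  qed
  have in_cball: "of_real t * v \<in> cball 0 t" if "norm v < 1" for v :: complex
    using that t mult_left_mono[of "norm v" 1 t] by (simp add: norm_mult)
  have "norm (?g (of_real t * z) - ?g (of_real t * w))
      \<le> 4 * B * kap * C / ((1 - t)\<^sup>2 * W t) * norm (of_real t * z - of_real t * w)"
  proof (rule field_differentiable_bound[where f' = "deriv ?g"])
    fix u :: complex assume u: "u \<in> cball 0 t"
    then have "u \<in> unit_disc" using t by simp
    then show "(?g has_field_derivative deriv ?g u) (at u within cball 0 t)"
      by (rule holomorphic_derivI[OF fK_holomorphic open_ball])
    show "norm (deriv ?g u) \<le> 4 * B * kap * C / ((1 - t)\<^sup>2 * W t)" using u by (rule g')
  qed (rule convex_cball in_cball z)+
  also have "\<dots> \<le> 4 * B * kap * C / ((1 - t)\<^sup>2 * W t) * norm (z - w)"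
  proof (rule mult_left_mono)
    have "norm (of_real t * z - of_real t * w) = t * norm (z - w)"
      using t by (simp flip: right_diff_distrib add: norm_mult)
    also have "\<dots> \<le> 1 * norm (z - w)" using t by (intro mult_right_mono) auto
    finally show "norm (of_real t * z - of_real t * w) \<le> norm (z - w)" by simp
    show "0 \<le> 4 * B * kap * C / ((1 - t)\<^sup>2 * W t)"
      using B_nonneg kap_pos C W_pos[OF t] by simp
  qed
  finally show ?thesis .
qed

text \<open>The entries of the minimum come from the size bound, the derivative bound and the gain
  near 1; only the second uses cancellation between the two values. Its constant 4 * 2, with |z - w|
  \<le> 2 |1 - w|, covers the other two since C \<ge> 1.\<close>

lemma norm_fK_diff_le_min:
  assumes z: "norm z < 1" "norm w < 1" and t: "0 \<le> t" "t < 1"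
    and le: "norm (1 - z) \<le> norm (1 - w)"
  shows "norm (f (of_real t * z) * K (of_real t * z) - f (of_real t * w) * K (of_real t * w))
    \<le> 8 * B * kap * C / ((1 - t) * W t) * min 1 (min (norm (1 - w) / (1 - t)) ((1 - t) / norm (1 - z)))"
    (is "?D \<le> ?Q * _")
proof -
  let ?g = "\<lambda>z. f z * K z"
  have W: "0 < W t" using t by (rule W_pos)
  have pos: "0 < norm (1 - z)" "0 < norm (1 - w)" using z by auto
  have Bk: "0 \<le> B * kap" using B_nonneg kap_pos by simp
  then have BkC: "B * kap \<le> B * kap * C" using mult_left_mono[OF C, of "B * kap"] by simp
  have le_t: "norm (of_real t * v) \<le> t" if "norm v < 1" for v :: complex
    using that t mult_left_mono[of "norm v" 1 t] by (simp add: norm_mult)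
  have tri: "?D \<le> norm (?g (of_real t * z)) + norm (?g (of_real t * w))" by (rule norm_triangle_ineq4)
  have "?D \<le> 2 * (B * kap / ((1 - t) * W t))"
    using tri norm_fK_le[OF le_t[OF z(1)] t(2)] norm_fK_le[OF le_t[OF z(2)] t(2)] by linarith
  also have "\<dots> = (2 * (B * kap)) / ((1 - t) * W t)" by simp
  also have "\<dots> \<le> ?Q"
  proof (rule divide_right_mono)
    have "8 * B * kap * C = 8 * (B * kap * C)" by simp
    then show "2 * (B * kap) \<le> 8 * B * kap * C" using BkC Bk by linarith
  qed (use W t in simp)
  finally have 1: "?D \<le> ?Q * 1" by simp
  have "?D \<le> 4 * B * kap * C / ((1 - t)\<^sup>2 * W t) * norm (z - w)"
    using z t by (rule norm_fK_diff_le)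
  also have "\<dots> \<le> 4 * B * kap * C / ((1 - t)\<^sup>2 * W t) * (2 * norm (1 - w))"
  proof (rule mult_left_mono)
    show "norm (z - w) \<le> 2 * norm (1 - w)"
      using norm_triangle_ineq4[of "1 - w" "1 - z"] le by simp
    show "0 \<le> 4 * B * kap * C / ((1 - t)\<^sup>2 * W t)"
      using B_nonneg kap_pos C W by simp
  qed
  also have "\<dots> = ?Q * (norm (1 - w) / (1 - t))" by (simp add: power2_eq_square mult_ac)
  finally have 2: "?D \<le> ?Q * (norm (1 - w) / (1 - t))" .
  have "norm (?g (of_real t * z)) \<le> 2 * B * kap / W t / norm (1 - z)"
    unfolding pos_le_divide_eq[OF pos(1)] using z(1) t by (rule norm_fK_le')
  moreover have "norm (?g (of_real t * w)) \<le> 2 * B * kap / W t / norm (1 - z)"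
  proof -
    have "norm (?g (of_real t * w)) \<le> 2 * B * kap / W t / norm (1 - w)"
      unfolding pos_le_divide_eq[OF pos(2)] using z(2) t by (rule norm_fK_le')
    also have "\<dots> \<le> 2 * B * kap / W t / norm (1 - z)"
      using le pos Bk W by (intro divide_left_mono mult_pos_pos) auto
    finally show ?thesis .
  qed
  ultimately have "?D \<le> 4 * (B * kap) / W t / norm (1 - z)" using tri by simp
  also have "\<dots> \<le> 8 * (B * kap * C) / W t / norm (1 - z)"
  proof (intro divide_right_mono)
    show "4 * (B * kap) \<le> 8 * (B * kap * C)" using BkC Bk by linarith
  qed (use W in auto)
  also have "\<dots> = ?Q * ((1 - t) / norm (1 - z))" using t by simp
  finally have 3: "?D \<le> ?Q * ((1 - t) / norm (1 - z))" .
  show ?thesis using 1 2 3 unfolding min_def by (simp only: split: if_split) blast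
qed

end

end

section \<open>The operator\<close>

lemma finite_borel_01D:
  assumes "\<mu> \<in> finite_borel_01"
  shows "space \<mu> = {0..<1}" "sets \<mu> = sets (restrict_space borel {0..<1})" "finite_measure \<mu>"
  using assms by (auto simp: finite_borel_01_def)

lemma finite_borel_01_sets:
  assumes "\<mu> \<in> finite_borel_01" "0 \<le> r"
  shows "{r..<1} \<in> sets \<mu>"
proof -
  have "{r..<1} = {0..<1} \<inter> {r..<1}" using assms(2) by auto
  then show ?thesis unfolding finite_borel_01D(2)[OF assms(1)] sets_restrict_space by auto
qed

lemma integrable_finite_borel_01:
  fixes h :: "real \<Rightarrow> 'a::{banach, second_countable_topology}"
  assumes \<mu>: "\<mu> \<in> finite_borel_01" and h: "continuous_on {0..<1} h"
    and bound: "\<And>t. 0 \<le> t \<Longrightarrow> t < 1 \<Longrightarrow> norm (h t) \<le> B"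
  shows "integrable \<mu> h"
proof -
  interpret finite_measure \<mu> using \<mu> by (rule finite_borel_01D)
  have "h \<in> borel_measurable \<mu>"
    using borel_measurable_continuous_on_restrict[OF h]
    by (simp only: measurable_cong_sets[OF finite_borel_01D(2)[OF \<mu>] refl])
  moreover have "AE t in \<mu>. norm (h t) \<le> B"
    using bound by (intro AE_I2) (simp add: finite_borel_01D(1)[OF \<mu>])
  ultimately show ?thesis by (intro integrable_const_bound)
qed

abbreviation mom :: "real measure \<Rightarrow> nat \<Rightarrow> real" where
  "mom \<mu> n \<equiv> (\<integral>t. t ^ n \<partial>\<mu>)"

lemma integrable_power_01:
  assumes "\<mu> \<in> finite_borel_01"
  shows "integrable \<mu> (\<lambda>t. t ^ n :: real)"
  using assms by (rule integrable_finite_borel_01[where B = 1])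
    (auto intro!: continuous_intros power_le_one)

lemma mom_antimono:
  assumes "\<mu> \<in> finite_borel_01" "n \<le> k"
  shows "mom \<mu> k \<le> mom \<mu> n"
  using assms finite_borel_01D(1)[OF assms(1)]
  by (intro integral_mono integrable_power_01) (auto intro: power_decreasing)

lemma mom_nonneg:
  assumes "\<mu> \<in> finite_borel_01"
  shows "0 \<le> mom \<mu> n"
  using finite_borel_01D(1)[OF assms] by (intro integral_nonneg_AE AE_I2) auto

lemma measure_moment_eq_mom:
  assumes "\<mu> \<in> finite_borel_01"
  shows "measure_moment \<mu> n = ennreal (mom \<mu> n)"
  unfolding measure_moment_def using finite_borel_01D(1)[OF assms]
  by (intro nn_integral_eq_integral integrable_power_01 assms AE_I2) auto

text \<open>\<mu> has space [0,1), whereas the measure of the weight lives on the line; the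
  indicator lets the dyadic lemmas serve both.\<close>

lemma nn_integral_finite_borel_01:
  assumes "\<mu> \<in> finite_borel_01"
  shows "(\<integral>\<^sup>+t. h t \<partial>\<mu>) = (\<integral>\<^sup>+t. h t * indicator {0..<1} t \<partial>\<mu>)"
  using finite_borel_01D(1)[OF assms] by (intro nn_integral_cong) auto

lemma norm_scaled_less_1:
  fixes z :: complex
  assumes "norm z < 1" "0 \<le> t" "t \<le> 1"
  shows "norm (of_real t * z) < 1"
  using assms mult_left_mono[of t 1 "norm z"] by (simp add: norm_mult mult.commute)

text \<open>Averaging over dilations multiplies each coefficient by the moment of \<mu> of that
  order. Absolute convergence at \<open>z\<close> dominates all dilations and justifies termwise
  integration.\<close>

lemma integral_power_series_01:
  fixes a :: "nat \<Rightarrow> complex"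
  assumes \<mu>: "\<mu> \<in> finite_borel_01" and a: "\<And>z. norm z < 1 \<Longrightarrow> summable (\<lambda>n. a n * z ^ n)"
    and z: "norm z < 1"
  shows "(\<lambda>n. a n * of_real (mom \<mu> n) * z ^ n) sums (\<integral>t. (\<Sum>n. a n * (of_real t * z) ^ n) \<partial>\<mu>)"
proof -
  obtain r where r: "norm z < r" "r < 1" using z dense by blast
  have r0: "0 < r" using r norm_ge_zero[of z] by linarith
  have abs: "summable (\<lambda>n. norm (a n * z ^ n))"
    using a[of "of_real r"] r r0 by (intro powser_insidea[of a "of_real r"]) auto
  have int: "integrable \<mu> (\<lambda>t. a n * (of_real t * z) ^ n)" for n
  proof -
    have "integrable \<mu> (\<lambda>t. of_real (t ^ n) * (a n * z ^ n))"
      using integrable_power_01[OF \<mu>] by (intro integrable_mult_left integrable_of_real)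
    then show ?thesis by (simp add: power_mult_distrib mult_ac)
  qed
  have le: "norm (a n * (of_real t * z) ^ n) \<le> norm (a n * z ^ n)" if "t \<in> {0..<1}" for n t
  proof -
    have "norm (a n * (of_real t * z) ^ n) = t ^ n * norm (a n * z ^ n)"
      using that by (simp add: norm_mult norm_power power_mult_distrib)
    also have "\<dots> \<le> 1 * norm (a n * z ^ n)"
      using that by (intro mult_right_mono power_le_one) auto
    finally show ?thesis by simp
  qed
  have "(\<lambda>n. \<integral>t. a n * (of_real t * z) ^ n \<partial>\<mu>) sums (\<integral>t. (\<Sum>n. a n * (of_real t * z) ^ n) \<partial>\<mu>)"
  proof (rule sums_integral[OF int])
    show "AE t in \<mu>. summable (\<lambda>n. norm (a n * (of_real t * z) ^ n))"
    proof (rule AE_I2)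
      fix t assume "t \<in> space \<mu>"
      then have "t \<in> {0..<1}" using finite_borel_01D(1)[OF \<mu>] by simp
      then show "summable (\<lambda>n. norm (a n * (of_real t * z) ^ n))"
        using le by (intro summable_comparison_test[OF _ abs]) auto
    qed
    have c: "summable (\<lambda>n. measure \<mu> (space \<mu>) * norm (a n * z ^ n))"
      using abs by (rule summable_mult)
    show "summable (\<lambda>n. \<integral>t. norm (a n * (of_real t * z) ^ n) \<partial>\<mu>)"
    proof (rule summable_comparison_test[OF _ c], intro exI allI impI)
      fix n
      interpret finite_measure \<mu> using \<mu> by (rule finite_borel_01D)
      have "(\<integral>t. norm (a n * (of_real t * z) ^ n) \<partial>\<mu>) \<le> (\<integral>t. norm (a n * z ^ n) \<partial>\<mu>)"
        using le finite_borel_01D(1)[OF \<mu>] by (intro integral_mono integrable_norm int) auto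
      then show "norm (\<integral>t. norm (a n * (of_real t * z) ^ n) \<partial>\<mu>) \<le> measure \<mu> (space \<mu>) * norm (a n * z ^ n)"
        by (simp add: integral_nonneg_AE abs_of_nonneg)
    qed
  qed
  moreover have "(\<integral>t. a n * (of_real t * z) ^ n \<partial>\<mu>) = a n * of_real (mom \<mu> n) * z ^ n" for n
  proof -
    have "(\<integral>t. a n * (of_real t * z) ^ n \<partial>\<mu>) = (\<integral>t. (a n * z ^ n) * complex_of_real (t ^ n) \<partial>\<mu>)"
      by (simp add: power_mult_distrib mult_ac)
    also have "\<dots> = (a n * z ^ n) * of_real (mom \<mu> n)"
      by (simp only: integral_mult_right_zero integral_complex_of_real)
    finally show ?thesis by (simp add: mult_ac)
  qed
  ultimately show ?thesis by (simp only:)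
qed

text \<open>Holomorphy is read off the Taylor series with coefficients multiplied by moments, which
  avoids differentiating under the integral.\<close>

lemma integral_dilations_holomorphic:
  assumes \<mu>: "\<mu> \<in> finite_borel_01" and g: "g holomorphic_on unit_disc"
  shows "(\<lambda>z. \<integral>t. g (of_real t * z) \<partial>\<mu>) holomorphic_on unit_disc"
proof -
  define a where "a n = (deriv ^^ n) g 0 / fact n" for n
  have sums: "(\<lambda>n. a n * z ^ n) sums g z" if "norm z < 1" for z
    using holomorphic_power_series[OF g, of z] that by (simp add: a_def)
  have F: "(\<lambda>n. a n * of_real (mom \<mu> n) * z ^ n) sums (\<integral>t. g (of_real t * z) \<partial>\<mu>)" if z: "norm z < 1" for z
  proof -
    have "(\<integral>t. g (of_real t * z) \<partial>\<mu>) = (\<integral>t. (\<Sum>n. a n * (of_real t * z) ^ n) \<partial>\<mu>)"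
    proof (rule Bochner_Integration.integral_cong[OF refl])
      fix t assume "t \<in> space \<mu>"
      then have "0 \<le> t" "t \<le> 1" using finite_borel_01D(1)[OF \<mu>] by auto
      then show "g (of_real t * z) = (\<Sum>n. a n * (of_real t * z) ^ n)"
        using sums_unique[OF sums[OF norm_scaled_less_1[OF z]]] by simp
    qed
    then show ?thesis
      using integral_power_series_01[OF \<mu> sums_summable[OF sums] z] by simp
  qed
  have "(\<lambda>z. \<Sum>n. a n * of_real (mom \<mu> n) * z ^ n) holomorphic_on unit_disc"
    using sums_summable[OF F] by (rule power_series_disc)
  then show ?thesis
    by (rule holomorphic_transform) (use F in \<open>auto simp: sums_iff\<close>)
qed

lemma continuous_on_dilations:
  fixes g :: "complex \<Rightarrow> complex"
  assumes g: "g holomorphic_on unit_disc" and z: "norm z < 1"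
  shows "continuous_on {0..<1} (\<lambda>t. g (of_real t * z))"
proof (rule continuous_on_compose2[OF holomorphic_on_imp_continuous_on[OF g]])
  show "continuous_on {0..<1} (\<lambda>t. of_real t * z)" by (intro continuous_intros)
  show "(\<lambda>t. of_real t * z) ` {0..<1} \<subseteq> unit_disc"
    using norm_scaled_less_1[OF z] by (auto simp del: norm_mult)
qed

context doubling_weight begin

text \<open>112 = 8 * 2 * 7: the pointwise difference bound, the comparison of 1 / (1 - t) with 2^k
  on a shell, and the sum over shells. One factor C stems from Cauchy's inequality, the other from
  comparing \<open>W t\<close> with \<open>W (dyad k)\<close>.\<close>

definition osc_const :: real where "osc_const = 112 * kap * C\<^sup>2"

lemma osc_const_pos: "0 < osc_const"
  using kap_pos C by (simp add: osc_const_def)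

lemma integral_fK_oscillation:
  assumes \<mu>: "\<mu> \<in> finite_borel_01" and M: "0 \<le> M"
    and tail: "\<And>k. emeasure \<mu> {dyad k..<1} \<le> ennreal (M * W (dyad k) * (1/2) ^ k)"
    and f: "f holomorphic_on unit_disc" and B: "\<And>z. norm z < 1 \<Longrightarrow> norm (f z) \<le> B"
    and z: "norm z < 1" and w: "norm w < 1"
  defines "F \<equiv> \<lambda>z. \<integral>t. f (of_real t * z) * K (of_real t * z) \<partial>\<mu>"
  shows "norm (F z - F w) \<le> osc_const * M * B * (1 + \<bar>ln (norm (1 - z) / norm (1 - w))\<bar>)"
proof -
  let ?g = "\<lambda>z. f z * K z"
  have B0: "0 \<le> B" using order_trans[OF norm_ge_zero B[of 0]] by simp
  have int: "integrable \<mu> (\<lambda>t. ?g (of_real t * z))" if z: "norm z < 1" for z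
  proof (rule integrable_finite_borel_01[OF \<mu> continuous_on_dilations])
    show "?g holomorphic_on unit_disc" using f B by (rule fK_holomorphic)
    fix t :: real assume t: "0 \<le> t" "t < 1"
    have "norm (of_real t * z) \<le> norm z"
      using t mult_left_mono[of t 1 "norm z"] by (simp add: norm_mult mult.commute)
    then show "norm (?g (of_real t * z)) \<le> B * kap / ((1 - norm z) * W (norm z))"
      using f B z by (intro norm_fK_le) auto
  qed fact
  \<comment> \<open>The pointwise bound is asymmetric in the two points, so one order is fixed; the
    other follows by exchanging them.\<close>
  have main: "norm (F z - F w) \<le> osc_const * M * B * (1 + ln (norm (1 - w) / norm (1 - z)))"
    if z: "norm z < 1" and w: "norm w < 1" and le: "norm (1 - z) \<le> norm (1 - w)" for z w
  proof -
    define \<psi> where "\<psi> k = min 1 (min (2 ^ Suc k * norm (1 - w)) ((1/2) ^ k / norm (1 - z)))" for k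
    have pos: "0 < norm (1 - z)" "0 < norm (1 - w)" using z w by auto
    have w2: "norm (1 - w) \<le> 2" using norm_triangle_ineq4[of 1 w] w by simp
    have \<psi>: "summable \<psi>" "suminf \<psi> \<le> 7 * (1 + ln (norm (1 - w) / norm (1 - z)))"
      unfolding \<psi>_def[abs_def] using suminf_two_sided_decay[OF pos(1) le w2] by simp_all
    have \<psi>0: "0 \<le> \<psi> k" for k by (simp add: \<psi>_def)
    define b where "b k = 8 * B * kap * C * (2 ^ Suc k * C / W (dyad k)) * \<psi> k" for k
    have b0: "0 \<le> b k" for k
      using B0 kap_pos C W_dyad_pos[of k] \<psi>0[of k] by (simp add: b_def)
    have "F z - F w = (\<integral>t. ?g (of_real t * z) - ?g (of_real t * w) \<partial>\<mu>)"
      unfolding F_def using int[OF z] int[OF w] by simp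
    then have "ennreal (norm (F z - F w)) \<le> (\<integral>\<^sup>+t. norm (?g (of_real t * z) - ?g (of_real t * w)) \<partial>\<mu>)"
      using int[OF z] int[OF w] by (simp only:) (intro integral_norm_bound_ennreal Bochner_Integration.integrable_diff)
    also have "\<dots> = (\<integral>\<^sup>+t. norm (?g (of_real t * z) - ?g (of_real t * w)) * indicator {0..<1} t \<partial>\<mu>)"
      by (subst nn_integral_finite_borel_01[OF \<mu>]) (simp add: ennreal_mult' ennreal_indicator)
    also have "\<dots> = (\<integral>\<^sup>+t. ennreal (norm (?g (of_real t * z) - ?g (of_real t * w))) * indicator {0..<1} t \<partial>\<mu>)"
      by (simp add: ennreal_mult' ennreal_indicator)
    also have "\<dots> \<le> (\<Sum>k. ennreal (b k) * emeasure \<mu> {dyad k..<1})"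
    proof (rule nn_integral_le_dyadic_tails)
      show "{dyad k..<1} \<in> sets \<mu>" for k using \<mu> by (intro finite_borel_01_sets) auto
      fix t :: real assume t: "0 \<le> t" "t < 1"
      then obtain k where k: "dyad k \<le> t" "t < dyad (Suc k)" by (rule dyad_shell)
      have s: "(1/2) ^ Suc k < 1 - t" "1 - t \<le> (1/2) ^ k"
        using k unfolding dyad_def by linarith+
      have inv: "1 / (1 - t) \<le> 2 ^ Suc k"
      proof -
        have "1 / (1 - t) \<le> 1 / (1/2) ^ Suc k" using s by (intro divide_left_mono mult_pos_pos) auto
        then show ?thesis by (simp add: power_divide)
      qed
      have "W (dyad k) \<le> C * W (dyad (Suc k))" using W_dyad_le[of k 1] by simp
      also have "\<dots> \<le> C * W t" using C k t by (intro mult_left_mono W_antimono) auto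
      finally have invW: "1 / W t \<le> C / W (dyad k)"
        using W_pos[OF t] W_dyad_pos[of k] by (simp add: field_simps)
      have "norm (?g (of_real t * z) - ?g (of_real t * w))
        \<le> 8 * B * kap * C / ((1 - t) * W t) * min 1 (min (norm (1 - w) / (1 - t)) ((1 - t) / norm (1 - z)))"
        using f B z w t le by (rule norm_fK_diff_le_min)
      also have "\<dots> = 8 * B * kap * C * (1 / (1 - t) * (1 / W t)) * min 1 (min (norm (1 - w) / (1 - t)) ((1 - t) / norm (1 - z)))"
        by simp
      also have "\<dots> \<le> 8 * B * kap * C * (2 ^ Suc k * (C / W (dyad k))) * \<psi> k"
      proof (intro mult_mono mult_left_mono inv invW)
        have "norm (1 - w) / (1 - t) = norm (1 - w) * (1 / (1 - t))" by simp
        also have "\<dots> \<le> norm (1 - w) * 2 ^ Suc k" using inv by (intro mult_left_mono) auto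
        finally have "norm (1 - w) / (1 - t) \<le> 2 ^ Suc k * norm (1 - w)" by (simp only: mult.commute)
        moreover have "(1 - t) / norm (1 - z) \<le> (1/2) ^ k / norm (1 - z)"
          using s by (intro divide_right_mono) auto
        ultimately show "min 1 (min (norm (1 - w) / (1 - t)) ((1 - t) / norm (1 - z))) \<le> \<psi> k"
          unfolding \<psi>_def by (intro min.mono order_refl)
      qed (use B0 kap_pos C W_pos[OF t] W_dyad_pos[of k] t in auto)
      finally have "norm (?g (of_real t * z) - ?g (of_real t * w)) \<le> b k" by (simp add: b_def)
      then show "\<exists>k. dyad k \<le> t \<and> ennreal (norm (?g (of_real t * z) - ?g (of_real t * w))) \<le> ennreal (b k)"
        using k(1) ennreal_leI by blast
    qed
    also have "\<dots> \<le> (\<Sum>k. ennreal (16 * B * kap * C\<^sup>2 * M * \<psi> k))"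
    proof (intro suminf_le summableI)
      fix k
      have "ennreal (b k) * emeasure \<mu> {dyad k..<1} \<le> ennreal (b k) * ennreal (M * W (dyad k) * (1/2) ^ k)"
        by (intro mult_left_mono tail) simp
      also have "\<dots> = ennreal (b k * (M * W (dyad k) * (1/2) ^ k))"
        using b0 by (rule ennreal_mult'[symmetric])
      \<comment> \<open>The tail bound on \<mu> cancels 2^k / W (dyad k) exactly, and only \<psi>
        remains to be summed.\<close>
      also have "b k * (M * W (dyad k) * (1/2) ^ k) = 16 * B * kap * C\<^sup>2 * M * \<psi> k"
        using W_dyad_pos[of k] by (simp add: b_def power2_eq_square power_divide)
      finally show "ennreal (b k) * emeasure \<mu> {dyad k..<1} \<le> ennreal (16 * B * kap * C\<^sup>2 * M * \<psi> k)" .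
    qed
    also have "\<dots> = ennreal (\<Sum>k. 16 * B * kap * C\<^sup>2 * M * \<psi> k)"
      using B0 kap_pos M \<psi>0 \<psi>(1) by (intro suminf_ennreal2 summable_mult) auto
    also have "(\<Sum>k. 16 * B * kap * C\<^sup>2 * M * \<psi> k) = 16 * B * kap * C\<^sup>2 * M * suminf \<psi>"
      using \<psi>(1) by (rule suminf_mult)
    finally have "norm (F z - F w) \<le> 16 * B * kap * C\<^sup>2 * M * suminf \<psi>"
      using B0 kap_pos M suminf_nonneg[OF \<psi>(1) \<psi>0] by (subst (asm) ennreal_le_iff) auto
    also have "\<dots> \<le> 16 * B * kap * C\<^sup>2 * M * (7 * (1 + ln (norm (1 - w) / norm (1 - z))))"
      using B0 kap_pos M by (intro mult_left_mono \<psi>) auto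
    finally show ?thesis by (simp add: osc_const_def mult_ac)
  qed
  have pos: "0 < norm (1 - z)" "0 < norm (1 - w)" using z w by auto
  show ?thesis
  proof (cases "norm (1 - z) \<le> norm (1 - w)")
    case True
    have "0 \<le> ln (norm (1 - w) / norm (1 - z))" using True pos by simp
    moreover have "ln (norm (1 - z) / norm (1 - w)) = - ln (norm (1 - w) / norm (1 - z))"
      using pos by (simp add: ln_div)
    ultimately show ?thesis using main[OF z w True] by simp
  next
    case False
    then have "0 \<le> ln (norm (1 - z) / norm (1 - w))" using pos by simp
    then show ?thesis using main[OF w z] False by (simp add: norm_minus_commute)
  qed
qed

lemma integral_fK_BMOA:
  assumes \<mu>: "\<mu> \<in> finite_borel_01" and M: "0 \<le> M"
    and tail: "\<And>k. emeasure \<mu> {dyad k..<1} \<le> ennreal (M * W (dyad k) * (1/2) ^ k)"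
    and f: "f holomorphic_on unit_disc" and B: "\<And>z. norm z < 1 \<Longrightarrow> norm (f z) \<le> B"
  defines "F \<equiv> \<lambda>z. \<integral>t. f (of_real t * z) * K (of_real t * z) \<partial>\<mu>"
  shows "F \<in> BMOA" "BMOA_norm F \<le> ennreal ((kap + osc_const * sqrt (2 + 2 * pi\<^sup>2)) * M * B)"
proof -
  have B0: "0 \<le> B" using order_trans[OF norm_ge_zero B[of 0]] by simp
  have F: "F holomorphic_on unit_disc"
    unfolding F_def using \<mu> fK_holomorphic[OF f B] by (rule integral_dilations_holomorphic)
  have A: "0 \<le> osc_const * M * B" using osc_const_pos M B0 by simp
  have osc: "norm (F z - F w) \<le> osc_const * M * B * (1 + \<bar>ln (norm (1 - z) / norm (1 - w))\<bar>)"
    if "norm z < 1" "norm w < 1" for z w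
    unfolding F_def using \<mu> M tail f B that by (rule integral_fK_oscillation)
  show "F \<in> BMOA" using F A osc by (rule BMOA_if_log_oscillation(1))
  have "norm (F 0) \<le> kap * M * B"
  proof -
    interpret finite_measure \<mu> using \<mu> by (rule finite_borel_01D)
    \<comment> \<open>At 0 the integrand is constant. The total mass is the tail at k = 0, whose
      factor \<open>W 0\<close> cancels against the kernel bound.\<close>
    have "F 0 = measure \<mu> (space \<mu>) *\<^sub>R (f 0 * K 0)" by (simp add: F_def)
    then have "norm (F 0) = measure \<mu> {0..<1} * norm (f 0 * K 0)"
      using finite_borel_01D(1)[OF \<mu>] by (simp add: norm_mult)
    also have "\<dots> \<le> (M * W 0) * (B * kap / ((1 - 0) * W 0))"
    proof (rule mult_mono)
      show "measure \<mu> {0..<1} \<le> M * W 0"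
        using tail[of 0] M W_dyad_pos[of 0] by (simp add: emeasure_eq_measure)
      show "norm (f 0 * K 0) \<le> B * kap / ((1 - 0) * W 0)"
        using f B by (intro norm_fK_le) auto
    qed (use M W_dyad_pos[of 0] in auto)
    also have "\<dots> = kap * M * B" using W_dyad_pos[of 0] by simp
    finally show ?thesis .
  qed
  then have "norm (F 0) + osc_const * M * B * sqrt (2 + 2 * pi\<^sup>2) \<le> (kap + osc_const * sqrt (2 + 2 * pi\<^sup>2)) * M * B"
    by (simp add: algebra_simps)
  then show "BMOA_norm F \<le> ennreal ((kap + osc_const * sqrt (2 + 2 * pi\<^sup>2)) * M * B)"
    using BMOA_if_log_oscillation(2)[OF F A osc] by (meson ennreal_leI order_trans)
qed


section \<open>Tails against moments of \<mu>, and the test function 1\<close>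

definition up_const :: real where
  "up_const = 8 * C * (exp 1 * growth_const (2 * C))"

lemma up_const_pos: "0 < up_const"
  using C growth_const_pos[of "2 * C"] by (simp add: up_const_def)

text \<open>One dyadic step back multiplies the bound M W 2^-k by at most 2 C, the C from doubling
  and the 2 from the length. Hence \<open>moment_le_dyadic_tail\<close> applies with D = 2
  C.\<close>

lemma moment_le_if_tail_le:
  assumes \<mu>: "\<mu> \<in> finite_borel_01" and M: "0 \<le> M"
    and tail: "\<And>k. emeasure \<mu> {dyad k..<1} \<le> ennreal (M * W (dyad k) * (1/2) ^ k)"
  shows "mom \<mu> n * real (n + 1) \<le> up_const * M * m n"
proof -
  obtain j where j: "2 ^ j \<le> Suc n" "Suc n < 2 ^ Suc j"
    using ex_power_ivl1[of 2 "Suc n"] by auto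
  let ?A = "M * W (dyad j) * (1/2) ^ j"
  have A: "0 \<le> ?A" using M W_dyad_pos[of j] by simp
  have G: "0 < growth_const (2 * C)" using C by (intro growth_const_pos) simp
  have "ennreal (mom \<mu> n) = (\<integral>\<^sup>+t. ennreal (t ^ n) * indicator {0..<1} t \<partial>\<mu>)"
    unfolding measure_moment_eq_mom[OF \<mu>, symmetric] measure_moment_def
    by (rule nn_integral_finite_borel_01[OF \<mu>])
  also have "\<dots> \<le> ennreal (exp 1 * growth_const (2 * C) * ?A)"
  proof (rule moment_le_dyadic_tail[OF _ _ A j(1)])
    show "{dyad k..<1} \<in> sets \<mu>" for k using \<mu> by (intro finite_borel_01_sets) auto
    show "0 < 2 * C" using C by simp
    fix k assume k: "k \<le> j"
    have "M * W (dyad k) * (1/2) ^ k \<le> M * (C ^ (j - k) * W (dyad j)) * (1/2) ^ k"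
      using W_dyad_le[of k "j - k"] k M by (intro mult_right_mono mult_left_mono) auto
    also have "\<dots> = (2 * C) ^ (j - k) * ?A"
    proof -
      have "(1/2::real) ^ k = 2 ^ (j - k) * (1/2) ^ j"
        using k by (simp add: power_divide power_diff)
      then show ?thesis by (simp add: power_mult_distrib mult_ac)
    qed
    finally have "M * W (dyad k) * (1/2) ^ k \<le> (2 * C) ^ (j - k) * ?A" .
    then show "emeasure \<mu> {dyad k..<1} \<le> ennreal ((2 * C) ^ (j - k) * ?A)"
      using tail[of k] ennreal_leI order_trans by blast
  qed
  finally have "mom \<mu> n \<le> exp 1 * growth_const (2 * C) * ?A"
    using A G by (subst (asm) ennreal_le_iff) auto
  then have "mom \<mu> n * real (n + 1) \<le> exp 1 * growth_const (2 * C) * ?A * (2 ^ Suc j)"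
    using A G j(2) of_nat_mono[of "Suc n" "2 ^ Suc j", where ?'a = real] by (intro mult_mono) auto
  also have "\<dots> = 2 * (exp 1 * growth_const (2 * C)) * M * W (dyad j)"
    by (simp add: power_divide)
  also have "\<dots> \<le> 2 * (exp 1 * growth_const (2 * C)) * M * (C * (4 * m n))"
  proof (rule mult_left_mono)
    \<comment> \<open>\<open>W_dyad_le_m\<close> needs n below the power of 2, so it is used at j +
      1, and one doubling leads there from j.\<close>
    have "W (dyad j) \<le> C * W (dyad (Suc j))" using W_dyad_le[of j 1] by simp
    also have "\<dots> \<le> C * (4 * m n)" using C j(2) by (intro mult_left_mono W_dyad_le_m) auto
    finally show "W (dyad j) \<le> C * (4 * m n)" .
  qed (use G M in auto)
  finally show ?thesis by (simp add: up_const_def mult_ac)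
qed

lemma tail_le_if_moment_le:
  assumes \<mu>: "\<mu> \<in> finite_borel_01" and M: "0 \<le> M" and Km: "0 \<le> Km"
    and upper: "\<And>n j. 2 ^ j \<le> Suc n \<Longrightarrow> m n \<le> Km * W (dyad j)"
    and mom: "\<And>n. mom \<mu> n * real (n + 1) \<le> M * m n"
    and r: "0 \<le> r" "r < 1"
  shows "emeasure \<mu> {r..<1} \<le> ennreal (8 * C * Km * M * (W r * (1 - r)))"
proof -
  obtain j where j: "dyad j \<le> r" "r < dyad (Suc j)" using r by (rule dyad_shell)
  \<comment> \<open>The only index meeting both constraints: n < 2^j for the tail bound and 2^j
    \<le> n + 1 for \<open>upper\<close>.\<close>
  define n where "n = 2 ^ j - (1::nat)"
  have n: "Suc n = 2 ^ j" by (simp add: n_def)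
  have sets: "{dyad j..<1} \<in> sets \<mu>" using \<mu> by (intro finite_borel_01_sets) auto
  have "emeasure \<mu> {r..<1} \<le> emeasure \<mu> {dyad j..<1}"
    using j sets by (intro emeasure_mono) auto
  also have "\<dots> \<le> 4 * (\<integral>\<^sup>+t. ennreal (t ^ n) * indicator {0..<1} t \<partial>\<mu>)"
    using sets n by (intro dyadic_tail_le_moment) auto
  also have "\<dots> = 4 * ennreal (mom \<mu> n)"
    unfolding measure_moment_eq_mom[OF \<mu>, symmetric] measure_moment_def
    by (simp only: nn_integral_finite_borel_01[OF \<mu>, symmetric])
  also have "\<dots> = ennreal (4 * mom \<mu> n)"
    by (simp add: ennreal_mult')
  also have "4 * mom \<mu> n \<le> 8 * C * Km * M * (W r * (1 - r))"
  proof -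
    have "mom \<mu> n * 2 ^ j \<le> M * m n"
      using mom[of n] n by (metis Suc_eq_plus1 of_nat_numeral of_nat_power)
    also have "\<dots> \<le> M * (Km * W (dyad j))" using n M by (intro mult_left_mono upper) auto
    also have "\<dots> \<le> M * (Km * (C * W r))"
    proof (intro mult_left_mono M Km)
      have "W (dyad j) \<le> C * W (dyad (Suc j))" using W_dyad_le[of j 1] by simp
      also have "\<dots> \<le> C * W r" using C j r by (intro mult_left_mono W_antimono) auto
      finally show "W (dyad j) \<le> C * W r" .
    qed
    finally have *: "mom \<mu> n * 2 ^ j \<le> M * (Km * (C * W r))" .
    have s: "(1/2) ^ j \<le> 2 * (1 - r)"
      using j unfolding dyad_def by (simp add: field_simps)
    have "mom \<mu> n = mom \<mu> n * 2 ^ j * (1/2) ^ j" by (simp add: power_divide)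
    also have "\<dots> \<le> M * (Km * (C * W r)) * (2 * (1 - r))"
      using s M Km C W_pos[OF r] by (intro mult_mono[OF *]) auto
    finally have "4 * mom \<mu> n \<le> 4 * (M * (Km * (C * W r)) * (2 * (1 - r)))" by simp
    also have "\<dots> = 8 * C * Km * M * (W r * (1 - r))" by simp
    finally show ?thesis .
  qed
  finally show ?thesis by (simp add: ennreal_leI)
qed

text \<open>The coefficients \<open>a n\<close> are nonnegative, so a block of the derivative series
  at a positive radius is at most the whole sum; on the block, monotonicity of both moment sequences
  replaces every coefficient by a single quotient.\<close>

lemma moment_le_if_Bloch_le:
  assumes \<mu>: "\<mu> \<in> finite_borel_01"
  defines "F \<equiv> \<lambda>z. \<integral>t. K (of_real t * z) \<partial>\<mu>"
  assumes F0: "norm (F 0) \<le> D"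
    and F': "\<And>z. norm z < 1 \<Longrightarrow> norm (deriv F z) * (1 - (norm z)\<^sup>2) \<le> D"
  shows "mom \<mu> n * real (n + 1) \<le> 64 * D * m n"
proof -
  define a where "a n = c n * mom \<mu> n" for n
  have mom0: "0 \<le> mom \<mu> n" for n using \<mu> by (rule mom_nonneg)
  have a0: "0 \<le> a n" for n using c_pos[of n] mom0[of n] by (simp add: a_def)
  have D: "0 \<le> D" using F0 norm_ge_zero order_trans by blast
  have F_sums: "(\<lambda>n. complex_of_real (a n) * z ^ n) sums F z" if "norm z < 1" for z
    using integral_power_series_01[OF \<mu> summable_norm_cancel[OF summable_norm_K] that]
    unfolding F_def K_def a_def by simp
  let ?S = "\<lambda>z. \<Sum>n. complex_of_real (a n) * z ^ n"
  have S: "?S holomorphic_on unit_disc"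
    using sums_summable[OF F_sums] by (rule power_series_disc)
  have FS: "F z = ?S z" if "norm z < 1" for z using F_sums[OF that] by (rule sums_unique)
  have F: "F holomorphic_on unit_disc"
    using S by (rule holomorphic_transform) (simp add: FS)
  have derivF: "deriv F z = (\<Sum>n. diffs (\<lambda>n. complex_of_real (a n)) n * z ^ n)" if "norm z < 1" for z
  proof -
    have "deriv F z = deriv ?S z"
      using F S that by (intro complex_derivative_transform_within_open[where s = unit_disc]) (auto simp: FS)
    then show ?thesis using power_series_disc(2)[OF sums_summable[OF F_sums] that] by simp
  qed
  show ?thesis
  \<comment> \<open>The radius 1 - 1/(2 n) requires n \<ge> 1; index 0 is read off
    \<open>F 0\<close>.\<close>
  proof (cases "n = 0")
    case True
    have "F 0 = of_real (a 0)" using F_sums[of 0] sums_unique2[OF powser_sums_zero] by force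
    then have "a 0 \<le> D" using F0 a0[of 0] by simp
    then have "mom \<mu> 0 \<le> 2 * D * m 1"
      using m_pos[of 1] by (simp add: a_def c_def field_simps)
    also have "\<dots> \<le> 64 * D * m 0"
      using m_antimono[of 0 1] m_pos[of 1] D by (intro mult_mono) auto
    finally show ?thesis using True by simp
  next
    case False
    let ?N = "real n"
    define r where "r = 1 - 1 / (2 * ?N)"
    have N: "1 \<le> ?N" using False by simp
    have r: "0 \<le> r" "r < 1" "1 - r = 1 / (2 * ?N)" using N by (auto simp: r_def field_simps)
    \<comment> \<open>Bernoulli gives 1 - n / (2 n) = 1/2, while 1 - r^2 is still at least 1 / (2
      n).\<close>
    have rn: "1 / 2 \<le> r ^ n"
      using Bernoulli_inequality[of "- (1 / (2 * ?N))" n] N r by (simp add: r_def field_simps)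
    define b where "b k = real (Suc k) * a (Suc k) * r ^ k" for k
    have b0: "0 \<le> b k" for k using a0 r by (simp add: b_def)
    have b_eq: "diffs (\<lambda>n. complex_of_real (a n)) k * of_real r ^ k = of_real (b k)" for k
      by (simp add: diffs_def b_def)
    have sm: "summable (\<lambda>k. complex_of_real (b k))"
    proof -
      have "summable (\<lambda>k. diffs (\<lambda>n. complex_of_real (a n)) k * of_real r ^ k)"
        by (rule termdiff_converges[of _ 1]) (use r sums_summable[OF F_sums] in auto)
      then show ?thesis by (simp only: b_eq)
    qed
    then have smb: "summable b" by (simp only: summable_complex_of_real)
    have "deriv F (of_real r) = of_real (suminf b)"
      using derivF[of "of_real r"] r unfolding b_eq by (simp add: suminf_of_real[OF smb])
    then have "suminf b * (1 - r\<^sup>2) \<le> D"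
      using F'[of "of_real r"] r suminf_nonneg[OF smb b0] by simp
    moreover have "suminf b * (1 - r) \<le> suminf b * (1 - r\<^sup>2)"
    proof (rule mult_left_mono)
      show "1 - r \<le> 1 - r\<^sup>2" using mult_left_mono[of r 1 r] r by (simp add: power2_eq_square)
    qed (rule suminf_nonneg[OF smb b0])
    ultimately have "suminf b * (1 - r) \<le> D" by linarith
    then have sb: "suminf b \<le> 2 * ?N * D"
      unfolding r(3) using N by (simp add: field_simps)
    \<comment> \<open>The lower end yields k + 1 \<ge> n/2 and 2 (k + 1) + 1 \<ge> n, which bounds
      the moment of the weight by \<open>m n\<close>; the upper end yields k + 1 \<le> n, so that
      the moment of \<mu> is at least \<open>mom \<mu> n\<close>.\<close>
    define I where "I = {n div 2..<n}"
    have cI: "?N / 2 \<le> real (card I)" unfolding I_def by simp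
    have "real (card I) * (?N / 2 * (mom \<mu> n / (2 * m n)) * (1/2)) = (\<Sum>k\<in>I. ?N / 2 * (mom \<mu> n / (2 * m n)) * (1/2))"
      by simp
    also have "\<dots> \<le> sum b I"
    proof (rule sum_mono)
      fix k assume "k \<in> I"
      then have k: "n div 2 \<le> k" "k < n" by (auto simp: I_def)
      have "mom \<mu> n / (2 * m n) \<le> mom \<mu> (Suc k) / (2 * m (2 * Suc k + 1))"
        using k mom0[of "Suc k"] m_pos \<mu> by (intro frac_le mom_antimono mult_left_mono m_antimono) auto
      then have "mom \<mu> n / (2 * m n) \<le> a (Suc k)" by (simp add: a_def c_def)
      moreover have "?N / 2 \<le> real (Suc k)" using k by linarith
      moreover have "1 / 2 \<le> r ^ k"
        using rn power_decreasing[of k n r] k r by linarith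
      ultimately show "?N / 2 * (mom \<mu> n / (2 * m n)) * (1/2) \<le> b k"
        unfolding b_def using mom0[of n] m_pos[of n] a0 by (intro mult_mono) auto
    qed
    also have "\<dots> \<le> suminf b" using smb b0 by (intro sum_le_suminf) (auto simp: I_def)
    finally have "real (card I) * (?N / 2 * (mom \<mu> n / (2 * m n)) * (1/2)) \<le> 2 * ?N * D"
      using sb by linarith
    moreover have "?N / 2 * (?N / 2 * (mom \<mu> n / (2 * m n)) * (1/2)) \<le> real (card I) * (?N / 2 * (mom \<mu> n / (2 * m n)) * (1/2))"
      using cI mom0[of n] m_pos[of n] by (intro mult_right_mono) auto
    ultimately have "?N / 2 * (?N / 2 * (mom \<mu> n / (2 * m n)) * (1/2)) \<le> 2 * ?N * D" by linarith
    \<comment> \<open>The left side is n^2 / 16 times mom / m; dividing 2 n D by n / 16 gives 32,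
      and n + 1 \<le> 2 n makes it 64.\<close>
    then have "?N * mom \<mu> n \<le> 32 * D * m n"
      using N m_pos[of n] by (simp add: field_simps)
    moreover have "mom \<mu> n * real (n + 1) \<le> 2 * (?N * mom \<mu> n)"
      using mult_right_mono[of "real (n + 1)" "2 * ?N" "mom \<mu> n"] N mom0[of n] by (simp add: mult_ac)
    ultimately show ?thesis by linarith
  qed
qed

end

section \<open>Tails and moments of a weight as an instance of the locale\<close>

lemma Dhat_doubling_weight:
  assumes \<omega>: "\<omega> \<in> Dhat"
  defines "W \<equiv> \<lambda>r. enn2real (weight_hat \<omega> r)" and "m \<equiv> \<lambda>n. enn2real (weight_moment \<omega> n)"
  obtains C Km where "doubling_weight W m C" "0 < Km"
    "\<And>n j. 2 ^ j \<le> Suc n \<Longrightarrow> m n \<le> Km * W (dyad j)"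
    "\<And>r. 0 \<le> r \<Longrightarrow> weight_hat \<omega> r = ennreal (W r)" "\<And>n. weight_moment \<omega> n = ennreal (m n)"
proof -
  from \<omega> obtain C where C: "1 < C"
    "\<And>r. 0 \<le> r \<Longrightarrow> r < 1 \<Longrightarrow> weight_hat \<omega> r \<le> ennreal C * weight_hat \<omega> ((1 + r) / 2)"
    and rw: "radial_weight \<omega>"
    unfolding Dhat_def by auto
  \<comment> \<open>Regarded as a measure, the weight is subject to the same two tail and moment
    lemmas as \<mu>.\<close>
  define \<nu> where "\<nu> = density lebesgue (ray_density \<omega>)"
  note meas = ray_density_measurable[OF rw]
  have sets: "{r..<1} \<in> sets \<nu>" for r by (simp add: \<nu>_def)
  have \<nu>_hat: "emeasure \<nu> {r..<1} = weight_hat \<omega> r" if "0 \<le> r" for r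
    unfolding \<nu>_def using that by (subst emeasure_density[OF meas]) (auto simp: weight_hat_eq_ray_density)
  have \<nu>_moment: "(\<integral>\<^sup>+t. ennreal (t ^ n) * indicator {0..<1} t \<partial>\<nu>) = weight_moment \<omega> n" for n
    unfolding \<nu>_def weight_moment_eq_ray_density
    by (rule nn_integral_density[OF meas]) (auto intro!: borel_measurable_times_ennreal measurable_completion)
  have hat: "weight_hat \<omega> r = ennreal (W r)" if "0 \<le> r" for r
    unfolding W_def using Dhat_weight_hat_finite[OF \<omega> that] by (simp add: less_top)
  have W_pos: "0 < W r" if "0 \<le> r" "r < 1" for r
    using Dhat_weight_hat_pos[OF \<omega> that] hat[OF that(1)] by (simp add: ennreal_less_zero_iff)
  have W_doubling: "W r \<le> C * W ((1 + r) / 2)" if "0 \<le> r" "r < 1" for r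
  proof -
    have "ennreal (W r) \<le> ennreal C * ennreal (W ((1 + r) / 2))"
      using C(2)[OF that] that by (simp add: hat)
    also have "\<dots> = ennreal (C * W ((1 + r) / 2))" using C(1) by (simp add: ennreal_mult')
    finally show ?thesis
      using C(1) W_pos[of "(1 + r) / 2"] that by (subst (asm) ennreal_le_iff) auto
  qed
  have W_antimono: "W s \<le> W r" if "0 \<le> r" "r \<le> s" "s < 1" for r s
    using weight_hat_antimono[OF that(2), of \<omega>] hat[of r] hat[of s] that W_pos[of r] by simp
  have moment_mono: "weight_moment \<omega> k \<le> weight_moment \<omega> n" if "n \<le> k" for n k
    unfolding weight_moment_eq_ray_density
    by (intro nn_integral_mono mult_left_mono)
      (auto split: split_indicator intro!: ennreal_leI power_decreasing that)
  \<comment> \<open>All moments are dominated by the one of order 0, the tail at 0; their finiteness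
    makes \<open>enn2real\<close> lossless.\<close>
  have "weight_moment \<omega> 0 = weight_hat \<omega> 0"
    unfolding weight_moment_eq_ray_density by (simp add: weight_hat_eq_ray_density)
  then have "weight_moment \<omega> n < \<infinity>" for n
    using moment_mono[of 0 n] Dhat_weight_hat_finite[OF \<omega>, of 0] by (auto intro: le_less_trans)
  then have moment: "weight_moment \<omega> n = ennreal (m n)" for n
    unfolding m_def by (simp add: less_top)
  have m0: "0 \<le> m n" for n by (simp add: m_def)
  have "doubling_weight W m C"
  proof
    show "m k \<le> m n" if "n \<le> k" for n k
      using moment_mono[OF that] m0 by (simp add: moment)
    show "W (dyad j) \<le> 4 * m n" if "n < 2 ^ j" for n j
    proof -
      have "ennreal (W (dyad j)) \<le> 4 * ennreal (m n)"
        using dyadic_tail_le_moment[OF sets that] by (simp add: \<nu>_hat hat \<nu>_moment moment)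
      also have "\<dots> = ennreal (4 * m n)" by (simp add: ennreal_mult')
      finally show ?thesis using m0[of n] by (subst (asm) ennreal_le_iff) auto
    qed
  qed (use C W_pos W_antimono W_doubling in auto)
  then interpret doubling_weight W m C .
  have "m n \<le> exp 1 * growth_const C * W (dyad j)" if "2 ^ j \<le> Suc n" for n j
  proof -
    have "ennreal (m n) \<le> ennreal (exp 1 * growth_const C * W (dyad j))"
      unfolding moment[symmetric] \<nu>_moment[symmetric]
    proof (rule moment_le_dyadic_tail[OF sets _ _ that])
      show "emeasure \<nu> {dyad k..<1} \<le> ennreal (C ^ (j - k) * W (dyad j))" if "k \<le> j" for k
        using W_dyad_le[of k "j - k"] that by (simp add: \<nu>_hat hat ennreal_leI)
    qed (use C W_dyad_pos in \<open>auto intro: less_imp_le\<close>)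
    then show ?thesis
      using growth_const_pos[of C] C(1) W_dyad_pos[of j] by (subst (asm) ennreal_le_iff) auto
  qed
  moreover have "0 < exp 1 * growth_const C" using growth_const_pos[of C] C(1) by simp
  ultimately show thesis using that \<open>doubling_weight W m C\<close> hat moment by blast
qed

section \<open>Operator norms and the cycle of inequalities\<close>

lemma comparable_onI:
  assumes "0 < a" "0 < b"
    and AB: "\<And>x. x \<in> S \<Longrightarrow> A x \<le> ennreal a * B x" and BA: "\<And>x. x \<in> S \<Longrightarrow> B x \<le> ennreal b * A x"
  shows "comparable_on S A B"
  unfolding comparable_on_def
proof (intro exI conjI ballI)
  show "0 < max a b" using assms by simp
  fix x assume x: "x \<in> S"
  have "A x \<le> ennreal a * B x" using x by (rule AB)
  also have "\<dots> \<le> ennreal (max a b) * B x" by (intro mult_right_mono ennreal_leI) auto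
  finally show "A x \<le> ennreal (max a b) * B x" .
  have "ennreal (1 / max a b) * B x \<le> ennreal (1 / max a b) * (ennreal b * A x)"
    by (intro mult_left_mono BA x) simp
  also have "\<dots> = ennreal (1 / max a b * b) * A x"
    using assms by (subst ennreal_mult) (auto simp: mult.assoc)
  also have "\<dots> \<le> ennreal 1 * A x"
    using assms by (intro mult_right_mono ennreal_leI) (auto simp: field_simps)
  finally show "ennreal (1 / max a b) * B x \<le> A x" by simp
qed

lemma ennreal_divide_le_iff:
  assumes "0 < x" "0 \<le> M"
  shows "a / ennreal x \<le> ennreal M \<longleftrightarrow> a \<le> ennreal (M * x)"
proof (cases a)
  case (real a')
  then show ?thesis using assms by (simp add: divide_ennreal field_simps)
next
  case top
  then show ?thesis using assms by (simp add: ennreal_top_divide top_unique)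
qed

lemma op_bounded_iff_op_norm: "op_bounded T X nX Y nY \<longleftrightarrow> op_norm T X nX Y nY < \<infinity>"
  unfolding op_bounded_def op_norm_def by (auto simp: INF_less_iff)

lemma op_norm_le:
  "op_bound T X nX Y nY C \<Longrightarrow> op_norm T X nX Y nY \<le> ennreal C"
  unfolding op_norm_def by (rule INF_lower) simp

lemma op_norm_Bloch_le_BMOA:
  "op_norm T Hinf Hinf_norm Bloch Bloch_norm \<le> op_norm T Hinf Hinf_norm BMOA BMOA_norm"
  unfolding op_norm_def
proof (rule INF_superset_mono)
  show "{C. op_bound T Hinf Hinf_norm BMOA BMOA_norm C} \<subseteq> {C. op_bound T Hinf Hinf_norm Bloch Bloch_norm C}"
  proof
    fix C assume "C \<in> {C. op_bound T Hinf Hinf_norm BMOA BMOA_norm C}"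
    then have C: "0 \<le> C" "\<And>f. f \<in> Hinf \<Longrightarrow> T f \<in> BMOA \<and> BMOA_norm (T f) \<le> ennreal C * Hinf_norm f"
      by (auto simp: op_bound_def)
    have "T f \<in> Bloch \<and> Bloch_norm (T f) \<le> ennreal C * Hinf_norm f" if "f \<in> Hinf" for f
    proof -
      have Tf: "T f \<in> BMOA" "BMOA_norm (T f) \<le> ennreal C * Hinf_norm f" using C(2)[OF that] by auto
      have "Bloch_norm (T f) \<le> BMOA_norm (T f)"
        using Tf(1) by (intro Bloch_norm_le_BMOA_norm) (simp add: BMOA_def H2_def)
      then show ?thesis using Tf BMOA_subset_Bloch by auto
    qed
    then show "C \<in> {C. op_bound T Hinf Hinf_norm Bloch Bloch_norm C}"
      using C(1) by (simp add: op_bound_def)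
  qed
qed simp

lemma Hinf_norm_eq_ennreal:
  assumes "f \<in> Hinf"
  obtains B where "0 \<le> B" "Hinf_norm f = ennreal B" "\<And>z. norm z < 1 \<Longrightarrow> norm (f z) \<le> B"
proof -
  obtain b where "\<forall>w\<in>f ` unit_disc. norm w \<le> b"
    using assms unfolding Hinf_def bounded_iff by blast
  then have b: "norm (f z) \<le> b" if "norm z < 1" for z using that by simp
  have "Hinf_norm f \<le> ennreal b"
    unfolding Hinf_norm_def using b by (intro SUP_least ennreal_leI) simp
  then have "Hinf_norm f < top" by (rule le_less_trans) simp
  then obtain B where B: "0 \<le> B" "Hinf_norm f = ennreal B"
    unfolding less_top_ennreal by blast
  have "norm (f z) \<le> B" if "norm z < 1" for z
  proof -
    have "ennreal (norm (f z)) \<le> Hinf_norm f"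
      unfolding Hinf_norm_def using that by (intro SUP_upper) simp
    then show ?thesis using B by simp
  qed
  then show ?thesis using that B by blast
qed

lemma Dhat_norm_bounds:
  assumes \<omega>: "\<omega> \<in> Dhat"
  obtains c1 c2 c3 where "0 < c1" "0 < c2" "0 < c3"
    "\<And>\<mu>. \<mu> \<in> finite_borel_01 \<Longrightarrow> L_infty_norm \<omega> \<mu> \<le> ennreal c1 * ell_infty_norm \<omega> \<mu>"
    "\<And>\<mu>. \<mu> \<in> finite_borel_01 \<Longrightarrow> ell_infty_norm \<omega> \<mu> \<le> ennreal c2 * L_infty_norm \<omega> \<mu>"
    "\<And>\<mu>. \<mu> \<in> finite_borel_01 \<Longrightarrow>
      op_norm (C_op \<mu> \<omega>) Hinf Hinf_norm BMOA BMOA_norm \<le> ennreal c3 * L_infty_norm \<omega> \<mu>"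
    "\<And>\<mu>. \<mu> \<in> finite_borel_01 \<Longrightarrow>
      ell_infty_norm \<omega> \<mu> \<le> ennreal 64 * op_norm (C_op \<mu> \<omega>) Hinf Hinf_norm Bloch Bloch_norm"
proof -
  define W where "W = (\<lambda>r. enn2real (weight_hat \<omega> r))"
  define m where "m = (\<lambda>n. enn2real (weight_moment \<omega> n))"
  obtain C Km where dw: "doubling_weight W m C" and Km: "0 < Km"
    and upper: "\<And>n j. 2 ^ j \<le> Suc n \<Longrightarrow> m n \<le> Km * W (dyad j)"
    and hat: "\<And>r. 0 \<le> r \<Longrightarrow> weight_hat \<omega> r = ennreal (W r)"
    and moment: "\<And>n. weight_moment \<omega> n = ennreal (m n)"
    using Dhat_doubling_weight[OF \<omega>] unfolding W_def m_def by metis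
  interpret doubling_weight W m C by (rule dw)
  have L_iff: "L_infty_norm \<omega> \<mu> \<le> ennreal M \<longleftrightarrow> (\<forall>r\<in>{0..<1}. emeasure \<mu> {r..<1} \<le> ennreal (M * (W r * (1 - r))))"
    if "0 \<le> M" for M \<mu>
  proof -
    have "measure_hat \<mu> r / (weight_hat \<omega> r * ennreal (1 - r)) \<le> ennreal M \<longleftrightarrow> emeasure \<mu> {r..<1} \<le> ennreal (M * (W r * (1 - r)))"
      if "r \<in> {0..<1}" for r
    proof -
      have r: "0 \<le> r" "r < 1" using that by auto
      have "weight_hat \<omega> r * ennreal (1 - r) = ennreal (W r * (1 - r))"
        using hat[OF r(1)] W_pos[OF r] r by (simp add: ennreal_mult)
      moreover have "0 < W r * (1 - r)" using W_pos[OF r] r by simp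
      ultimately show ?thesis
        using ennreal_divide_le_iff[of "W r * (1 - r)" M "measure_hat \<mu> r"] \<open>0 \<le> M\<close>
        by (simp add: measure_hat_def)
    qed
    then show ?thesis unfolding L_infty_norm_def SUP_le_iff by blast
  qed
  have ell_iff: "ell_infty_norm \<omega> \<mu> \<le> ennreal M \<longleftrightarrow> (\<forall>n. mom \<mu> n * real (n + 1) \<le> M * m n)"
    if \<mu>: "\<mu> \<in> finite_borel_01" and M: "0 \<le> M" for M \<mu>
  proof -
    have "measure_moment \<mu> n * of_nat (n + 1) / weight_moment \<omega> n \<le> ennreal M \<longleftrightarrow> mom \<mu> n * real (n + 1) \<le> M * m n" for n
    proof -
      have "measure_moment \<mu> n * of_nat (n + 1) = ennreal (mom \<mu> n * real (n + 1))"
        unfolding measure_moment_eq_mom[OF \<mu>] ennreal_of_nat_eq_real_of_nat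
        using mom_nonneg[OF \<mu>] by (intro ennreal_mult[symmetric]) auto
      then show ?thesis
        using ennreal_divide_le_iff[OF m_pos M, of "measure_moment \<mu> n * of_nat (n + 1)" n]
          M m_pos[of n] by (simp add: moment ennreal_le_iff del: of_nat_add)
    qed
    then show ?thesis unfolding ell_infty_norm_def SUP_le_iff by blast
  qed
  have C_op_eq: "C_op \<mu> \<omega> f = (\<lambda>z. \<integral>t. f (of_real t * z) * K (of_real t * z) \<partial>\<mu>)" for \<mu> f
  proof -
    have "kernel_B \<omega> t z = K (of_real t * z)" for t z
      unfolding kernel_B_def K_def c_def by (simp add: m_def)
    then show ?thesis by (simp add: C_op_def fun_eq_iff)
  qed
  define c1 where "c1 = 8 * C * Km"
  define c3 where "c3 = kap + osc_const * sqrt (2 + 2 * pi\<^sup>2)"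
  have c1: "0 < c1" using C Km by (simp add: c1_def)
  have c3: "0 < c3" using kap_pos osc_const_pos by (simp add: c3_def add_pos_nonneg)
  have 1: "L_infty_norm \<omega> \<mu> \<le> ennreal c1 * ell_infty_norm \<omega> \<mu>" if \<mu>: "\<mu> \<in> finite_borel_01" for \<mu>
  proof (cases "ell_infty_norm \<omega> \<mu>")
    case (real M)
    then have "\<And>n. mom \<mu> n * real (n + 1) \<le> M * m n" using ell_iff[OF \<mu>, of M] by simp
    then have "L_infty_norm \<omega> \<mu> \<le> ennreal (c1 * M)"
      using tail_le_if_moment_le[OF \<mu> _ _ upper] real Km c1 by (subst L_iff) (auto simp: c1_def)
    then show ?thesis using real c1 by (simp add: ennreal_mult)
  \<comment> \<open>In the infinite case the right-hand side is \<infinity>, because the constant is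
    positive.\<close>
  qed (use c1 in \<open>simp add: ennreal_mult_top\<close>)
  have tail: "emeasure \<mu> {dyad k..<1} \<le> ennreal (M * W (dyad k) * (1/2) ^ k)"
    if "L_infty_norm \<omega> \<mu> = ennreal M" "0 \<le> M" for \<mu> M k
  proof -
    have "emeasure \<mu> {dyad k..<1} \<le> ennreal (M * (W (dyad k) * (1 - dyad k)))"
      using that L_iff[of M \<mu>] by simp
    then show ?thesis by (simp add: dyad_def mult.assoc)
  qed
  have 2: "ell_infty_norm \<omega> \<mu> \<le> ennreal up_const * L_infty_norm \<omega> \<mu>" if \<mu>: "\<mu> \<in> finite_borel_01" for \<mu>
  proof (cases "L_infty_norm \<omega> \<mu>")
    case (real M)
    have "ell_infty_norm \<omega> \<mu> \<le> ennreal (up_const * M)"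
      using moment_le_if_tail_le[OF \<mu> real(1) tail[OF real(2,1)]] real up_const_pos
      by (subst ell_iff[OF \<mu>]) auto
    then show ?thesis using real up_const_pos by (simp add: ennreal_mult)
  qed (use up_const_pos in \<open>simp add: ennreal_mult_top\<close>)
  have 3: "op_norm (C_op \<mu> \<omega>) Hinf Hinf_norm BMOA BMOA_norm \<le> ennreal c3 * L_infty_norm \<omega> \<mu>"
    if \<mu>: "\<mu> \<in> finite_borel_01" for \<mu>
  proof (cases "L_infty_norm \<omega> \<mu>")
    case (real M)
    have "op_bound (C_op \<mu> \<omega>) Hinf Hinf_norm BMOA BMOA_norm (c3 * M)"
      unfolding op_bound_def
    proof (intro conjI ballI)
      show "0 \<le> c3 * M" using c3 real by simp
      fix f assume f: "f \<in> Hinf"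
      then obtain B where B: "0 \<le> B" "Hinf_norm f = ennreal B" "\<And>z. norm z < 1 \<Longrightarrow> norm (f z) \<le> B"
        by (rule Hinf_norm_eq_ennreal) blast
      have hol: "f holomorphic_on unit_disc" using f by (simp add: Hinf_def)
      note F = integral_fK_BMOA[OF \<mu> real(1) tail[OF real(2,1)] hol B(3), folded C_op_eq]
      show "C_op \<mu> \<omega> f \<in> BMOA" by (rule F(1))
      have "BMOA_norm (C_op \<mu> \<omega> f) \<le> ennreal (c3 * M * B)" using F(2) by (simp only: c3_def)
      also have "\<dots> = ennreal (c3 * M) * Hinf_norm f"
        unfolding B(2) using c3 real B(1) by (intro ennreal_mult) auto
      finally show "BMOA_norm (C_op \<mu> \<omega> f) \<le> ennreal (c3 * M) * Hinf_norm f" .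
    qed
    then have "op_norm (C_op \<mu> \<omega>) Hinf Hinf_norm BMOA BMOA_norm \<le> ennreal (c3 * M)" by (rule op_norm_le)
    then show ?thesis using real c3 by (simp add: ennreal_mult)
  qed (use c3 in \<open>simp add: ennreal_mult_top\<close>)
  have 4: "ell_infty_norm \<omega> \<mu> \<le> ennreal 64 * op_norm (C_op \<mu> \<omega>) Hinf Hinf_norm Bloch Bloch_norm"
    if \<mu>: "\<mu> \<in> finite_borel_01" for \<mu>
  proof -
    have le: "ell_infty_norm \<omega> \<mu> \<le> ennreal (64 * D)"
      if D: "op_bound (C_op \<mu> \<omega>) Hinf Hinf_norm Bloch Bloch_norm D" for D
    proof -
      have D0: "0 \<le> D" using D by (simp add: op_bound_def)
      have one: "(\<lambda>_. 1) \<in> Hinf" by (auto simp: Hinf_def bounded_iff)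
      let ?F = "\<lambda>z. \<integral>t. K (of_real t * z) \<partial>\<mu>"
      have F: "C_op \<mu> \<omega> (\<lambda>_. 1) = ?F" by (simp add: C_op_eq)
      have "Hinf_norm (\<lambda>_. 1) = 1" by (simp add: Hinf_norm_def)
      then have "Bloch_norm ?F \<le> ennreal D"
        using D one F unfolding op_bound_def by (metis mult.right_neutral)
      then have sum: "ennreal (norm (?F 0)) + (SUP z\<in>unit_disc. ennreal (norm (deriv ?F z) * (1 - (norm z)\<^sup>2))) \<le> ennreal D"
        by (simp only: Bloch_norm_def)
      have "ennreal (norm (?F 0)) \<le> ennreal D"
        using sum by (rule order_trans[rotated]) simp
      then have F0: "norm (?F 0) \<le> D" using D0 by simp
      have F': "norm (deriv ?F z) * (1 - (norm z)\<^sup>2) \<le> D" if z: "norm z < 1" for z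
      proof -
        have "ennreal (norm (deriv ?F z) * (1 - (norm z)\<^sup>2))
          \<le> (SUP z\<in>unit_disc. ennreal (norm (deriv ?F z) * (1 - (norm z)\<^sup>2)))"
          using z by (intro SUP_upper) simp
        also have "\<dots> \<le> ennreal D" using sum by (rule order_trans[rotated]) simp
        finally show ?thesis using D0 by (simp add: ennreal_le_iff)
      qed
      show ?thesis
        using moment_le_if_Bloch_le[OF \<mu> F0 F'] D0 by (subst ell_iff[OF \<mu>]) auto
    qed
    \<comment> \<open>With the factor on the left the claim is a lower bound for each D in the
      infimum. If no bound D exists, the infimum is \<infinity> and nothing has to be shown.\<close>
    have "ennreal (1/64) * ell_infty_norm \<omega> \<mu> \<le> op_norm (C_op \<mu> \<omega>) Hinf Hinf_norm Bloch Bloch_norm"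
      unfolding op_norm_def
    proof (rule INF_greatest)
      fix D assume "D \<in> {D. op_bound (C_op \<mu> \<omega>) Hinf Hinf_norm Bloch Bloch_norm D}"
      then have "ennreal (1/64) * ell_infty_norm \<omega> \<mu> \<le> ennreal (1/64) * ennreal (64 * D)"
        by (intro mult_left_mono le) auto
      also have "\<dots> = ennreal (1/64 * (64 * D))" by (rule ennreal_mult'[symmetric]) simp
      finally show "ennreal (1/64) * ell_infty_norm \<omega> \<mu> \<le> ennreal D" by simp
    qed
    then have "ennreal 64 * (ennreal (1/64) * ell_infty_norm \<omega> \<mu>) \<le> ennreal 64 * op_norm (C_op \<mu> \<omega>) Hinf Hinf_norm Bloch Bloch_norm"
      by (rule mult_left_mono) simp
    moreover have "ennreal 64 * (ennreal (1/64) * ell_infty_norm \<omega> \<mu>) = ell_infty_norm \<omega> \<mu>"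
    proof -
      have "ennreal 64 * ennreal (1/64) = ennreal (64 * (1/64))" by (rule ennreal_mult'[symmetric]) simp
      then show ?thesis unfolding mult.assoc[symmetric] by simp
    qed
    ultimately show ?thesis by simp
  qed
  show thesis using that[OF c1 up_const_pos c3 1 2 3 4] .
qed

theorem theorem4:
  fixes \<omega> :: "complex \<Rightarrow> real"
  assumes "\<omega> \<in> Dhat"
  shows "(\<forall>\<mu>\<in>finite_borel_01.
            (op_bounded (C_op \<mu> \<omega>) Hinf Hinf_norm BMOA BMOA_norm
               \<longleftrightarrow> op_bounded (C_op \<mu> \<omega>) Hinf Hinf_norm Bloch Bloch_norm)
          \<and> (op_bounded (C_op \<mu> \<omega>) Hinf Hinf_norm Bloch Bloch_norm
               \<longleftrightarrow> L_infty_norm \<omega> \<mu> < \<infinity>)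
          \<and> (L_infty_norm \<omega> \<mu> < \<infinity> \<longleftrightarrow> ell_infty_norm \<omega> \<mu> < \<infinity>))
       \<and> comparable_on finite_borel_01
            (\<lambda>\<mu>. op_norm (C_op \<mu> \<omega>) Hinf Hinf_norm Bloch Bloch_norm)
            (\<lambda>\<mu>. op_norm (C_op \<mu> \<omega>) Hinf Hinf_norm BMOA BMOA_norm)
       \<and> comparable_on finite_borel_01
            (\<lambda>\<mu>. op_norm (C_op \<mu> \<omega>) Hinf Hinf_norm BMOA BMOA_norm)
            (\<lambda>\<mu>. L_infty_norm \<omega> \<mu>)
       \<and> comparable_on finite_borel_01
            (\<lambda>\<mu>. L_infty_norm \<omega> \<mu>)
            (\<lambda>\<mu>. ell_infty_norm \<omega> \<mu>)"
proof -
  let ?Bl = "\<lambda>\<mu>. op_norm (C_op \<mu> \<omega>) Hinf Hinf_norm Bloch Bloch_norm"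
  let ?BM = "\<lambda>\<mu>. op_norm (C_op \<mu> \<omega>) Hinf Hinf_norm BMOA BMOA_norm"
  obtain c1 c2 c3 where c: "0 < c1" "0 < c2" "0 < c3"
    and L_ell: "\<And>\<mu>. \<mu> \<in> finite_borel_01 \<Longrightarrow> L_infty_norm \<omega> \<mu> \<le> ennreal c1 * ell_infty_norm \<omega> \<mu>"
    and ell_L: "\<And>\<mu>. \<mu> \<in> finite_borel_01 \<Longrightarrow> ell_infty_norm \<omega> \<mu> \<le> ennreal c2 * L_infty_norm \<omega> \<mu>"
    and BM_L: "\<And>\<mu>. \<mu> \<in> finite_borel_01 \<Longrightarrow> ?BM \<mu> \<le> ennreal c3 * L_infty_norm \<omega> \<mu>"
    and ell_Bl: "\<And>\<mu>. \<mu> \<in> finite_borel_01 \<Longrightarrow> ell_infty_norm \<omega> \<mu> \<le> ennreal 64 * ?Bl \<mu>"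
    using Dhat_norm_bounds[OF assms] by blast
  have Bl_BM: "?Bl \<mu> \<le> ?BM \<mu>" for \<mu> by (rule op_norm_Bloch_le_BMOA)
  have L_Bl: "L_infty_norm \<omega> \<mu> \<le> ennreal (c1 * 64) * ?Bl \<mu>" if "\<mu> \<in> finite_borel_01" for \<mu>
  proof -
    have "L_infty_norm \<omega> \<mu> \<le> ennreal c1 * (ennreal 64 * ?Bl \<mu>)"
      using L_ell[OF that] mult_left_mono[OF ell_Bl[OF that], of "ennreal c1"] by (metis order_trans zero_le)
    then show ?thesis using c by (subst ennreal_mult) (auto simp: mult.assoc)
  qed
  have L_BM: "L_infty_norm \<omega> \<mu> \<le> ennreal (c1 * 64) * ?BM \<mu>" if "\<mu> \<in> finite_borel_01" for \<mu>
    using L_Bl[OF that] mult_left_mono[OF Bl_BM[of \<mu>], of "ennreal (c1 * 64)"] by (metis order_trans zero_le)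
  \<comment> \<open>A Bloch function need not lie in BMOA, so this bound cannot be had function by
    function; it goes round the cycle through the tail condition on \<mu>.\<close>
  have BM_Bl: "?BM \<mu> \<le> ennreal (c3 * (c1 * 64)) * ?Bl \<mu>" if "\<mu> \<in> finite_borel_01" for \<mu>
  proof -
    have "?BM \<mu> \<le> ennreal c3 * (ennreal (c1 * 64) * ?Bl \<mu>)"
      using BM_L[OF that] mult_left_mono[OF L_Bl[OF that], of "ennreal c3"] by (metis order_trans zero_le)
    also have "\<dots> = ennreal (c3 * (c1 * 64)) * ?Bl \<mu>"
      using c by (subst ennreal_mult[of c3]) (auto simp: mult.assoc)
    finally show ?thesis .
  qed
  have fin: "x < \<infinity>" if "x \<le> ennreal a * y" "y < \<infinity>" for x y a
    using that by (auto simp: ennreal_mult_less_top intro: le_less_trans)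
  show ?thesis
  proof (intro conjI ballI)
    fix \<mu> :: "real measure" assume \<mu>: "\<mu> \<in> finite_borel_01"
    show "op_bounded (C_op \<mu> \<omega>) Hinf Hinf_norm BMOA BMOA_norm
      \<longleftrightarrow> op_bounded (C_op \<mu> \<omega>) Hinf Hinf_norm Bloch Bloch_norm"
      unfolding op_bounded_iff_op_norm using Bl_BM[of \<mu>] fin[OF BM_Bl[OF \<mu>]] le_less_trans by blast
    show "op_bounded (C_op \<mu> \<omega>) Hinf Hinf_norm Bloch Bloch_norm \<longleftrightarrow> L_infty_norm \<omega> \<mu> < \<infinity>"
      unfolding op_bounded_iff_op_norm
      using fin[OF L_Bl[OF \<mu>]] fin[OF BM_L[OF \<mu>]] Bl_BM[of \<mu>] le_less_trans by blast
    show "L_infty_norm \<omega> \<mu> < \<infinity> \<longleftrightarrow> ell_infty_norm \<omega> \<mu> < \<infinity>"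
      using fin[OF L_ell[OF \<mu>]] fin[OF ell_L[OF \<mu>]] by blast
  next
    show "comparable_on finite_borel_01 ?Bl ?BM"
      by (rule comparable_onI[of 1 "c3 * (c1 * 64)"]) (use c Bl_BM BM_Bl in auto)
    show "comparable_on finite_borel_01 ?BM (\<lambda>\<mu>. L_infty_norm \<omega> \<mu>)"
      by (rule comparable_onI[of c3 "c1 * 64"]) (use c BM_L L_BM in auto)
    show "comparable_on finite_borel_01 (\<lambda>\<mu>. L_infty_norm \<omega> \<mu>) (\<lambda>\<mu>. ell_infty_norm \<omega> \<mu>)"
      by (rule comparable_onI[of c1 c2]) (use c L_ell ell_L in auto)
  qed
qed

end
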